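(* Let $f\in\mathcal{A}$ and $\gamma\in[0,1)$. If $|\arg f'(z)|\le \gamma\pi/2$ for all $z\in\mathbb{D}$, then $f$ belongs to $\mathcal{R}$ and has a $\sin(\gamma\pi/2)$-quasiconformal extension to $\mathbb{C}$.
   Context: $\mathbb{D}=\{z\in\mathbb{C}:|z|<1\}$. $\mathcal{A}$ is the family of analytic functions $f$ on $\mathbb{D}$ with $f(0)=0$, $f'(0)=1$. $\mathcal{R}=\{f\in\mathcal{A}: \operatorname{Re} f'(z)>0 \text{ for all } z\in\mathbb{D}\}$. The hypothesis $|\arg f'(z)|\le\gamma\pi/2$ includes that $f'(z)\neq0$, and $\arg$ is the principal argument. A homeomorphism $F$ on a domain $G$ is $k$-quasiconformal ($0\le k<1$) if its distributional derivatives $\partial_{\bar z}F$ and $\partial_zF$ are locally integrable on $G$ and $|\partial_{\bar z}F|\le k|\partial_zF|$ a.e. in $G$. A univalent $f\in\mathcal{A}$ has a $k$-quasiconformal extension to $\mathbb{C}$ if there is a $k$-quasiconformal homeomorphism $F$ of $\mathbb{C}$ onto $\mathbb{C}$ whose restriction to $\mathbb{D}$ equals $f$. *)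

theory Defs
  imports "HOL-Analysis.Analysis"
begin

definition class_A :: "(complex \<Rightarrow> complex) set" where
  "class_A = {f. f holomorphic_on ball 0 1 \<and> f 0 = 0 \<and> deriv f 0 = 1}"

definition class_R :: "(complex \<Rightarrow> complex) set" where
  "class_R = {f \<in> class_A. \<forall>z\<in>ball 0 1. Re (deriv f z) > 0}"

text \<open>The classical partial derivatives in the real coordinates \<open>z = x + \<i> y\<close> and the
  Wirtinger derivatives. Here the Frechet derivative is real-linear, so \<open>f\<close> need not be
  complex differentiable.\<close>

definition partial_x :: "(complex \<Rightarrow> complex) \<Rightarrow> complex \<Rightarrow> complex" where
  "partial_x f z = frechet_derivative f (at z) 1"

definition partial_y :: "(complex \<Rightarrow> complex) \<Rightarrow> complex \<Rightarrow> complex" where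
  "partial_y f z = frechet_derivative f (at z) \<i>"

definition wirtinger :: "(complex \<Rightarrow> complex) \<Rightarrow> complex \<Rightarrow> complex" where
  "wirtinger f z = (partial_x f z - \<i> * partial_y f z) / 2"

definition wirtinger_bar :: "(complex \<Rightarrow> complex) \<Rightarrow> complex \<Rightarrow> complex" where
  "wirtinger_bar f z = (partial_x f z + \<i> * partial_y f z) / 2"

text \<open>\<open>C_k n f\<close>: the function \<open>f\<close> is \<open>n\<close> times continuously (real) differentiable on the plane.\<close>

primrec C_k :: "nat \<Rightarrow> (complex \<Rightarrow> complex) \<Rightarrow> bool" where
  "C_k 0 f \<longleftrightarrow> continuous_on UNIV f"
| "C_k (Suc n) f \<longleftrightarrow>
    (\<forall>z. f differentiable (at z)) \<and> C_k n (partial_x f) \<and> C_k n (partial_y f)"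

definition test_functions :: "complex set \<Rightarrow> (complex \<Rightarrow> complex) set" where
  "test_functions G = {\<phi>. (\<forall>n. C_k n \<phi>) \<and>
     compact (closure {z. \<phi> z \<noteq> 0}) \<and> closure {z. \<phi> z \<noteq> 0} \<subseteq> G}"

definition locally_integrable_on :: "(complex \<Rightarrow> complex) \<Rightarrow> complex set \<Rightarrow> bool" where
  "locally_integrable_on g G \<longleftrightarrow>
     (\<forall>K. compact K \<and> K \<subseteq> G \<longrightarrow> g absolutely_integrable_on K)"

text \<open>The next two predicates say that the locally integrable function \<open>g\<close> represents the
  distributional derivative of \<open>F\<close> with respect to \<open>z\<close>, respectively to the conjugate of \<open>z\<close>,
  on the open set \<open>G\<close>. Local integrability ensures that no integral takes its default value.\<close>

definition has_distr_deriv_z ::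
    "(complex \<Rightarrow> complex) \<Rightarrow> (complex \<Rightarrow> complex) \<Rightarrow> complex set \<Rightarrow> bool" where
  "has_distr_deriv_z F g G \<longleftrightarrow>
     locally_integrable_on F G \<and> locally_integrable_on g G \<and>
     (\<forall>\<phi>\<in>test_functions G.
        (LINT z:G|lebesgue. g z * \<phi> z) = - (LINT z:G|lebesgue. F z * wirtinger \<phi> z))"

definition has_distr_deriv_zbar ::
    "(complex \<Rightarrow> complex) \<Rightarrow> (complex \<Rightarrow> complex) \<Rightarrow> complex set \<Rightarrow> bool" where
  "has_distr_deriv_zbar F g G \<longleftrightarrow>
     locally_integrable_on F G \<and> locally_integrable_on g G \<and>
     (\<forall>\<phi>\<in>test_functions G.
        (LINT z:G|lebesgue. g z * \<phi> z) = - (LINT z:G|lebesgue. F z * wirtinger_bar \<phi> z))"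

text \<open>Quasiconformal homeomorphisms of a domain \<open>G\<close> onto its image.\<close>

definition quasiconformal_on :: "real \<Rightarrow> (complex \<Rightarrow> complex) \<Rightarrow> complex set \<Rightarrow> bool" where
  "quasiconformal_on k F G \<longleftrightarrow>
     0 \<le> k \<and> k < 1 \<and> open G \<and> connected G \<and> G \<noteq> {} \<and>
     (\<exists>F'. homeomorphism G (F ` G) F F') \<and>
     (\<exists>Fz Fzbar. has_distr_deriv_z F Fz G \<and> has_distr_deriv_zbar F Fzbar G \<and>
        (AE z in lebesgue. z \<in> G \<longrightarrow> norm (Fzbar z) \<le> k * norm (Fz z)))"

definition has_quasiconformal_extension :: "real \<Rightarrow> (complex \<Rightarrow> complex) \<Rightarrow> bool" where
  "has_quasiconformal_extension k f \<longleftrightarrow>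
     f \<in> class_A \<and> inj_on f (ball 0 1) \<and>
     (\<exists>F. quasiconformal_on k F UNIV \<and> range F = UNIV \<and> (\<forall>z\<in>ball 0 1. F z = f z))"

end

theory Submission
  imports Defs "HOL-Complex_Analysis.Complex_Analysis"
begin

text \<open>
  The extension is given by a formula. Put \<open>\<alpha> = \<gamma> * pi / 2\<close> and, for \<open>0 < \<bar>\<zeta>\<bar> < 1\<close>,
  \<open>h \<zeta> = (1 / \<bar>\<zeta>\<bar>^2 - 1) / cos \<alpha> * \<bar>f' \<zeta>\<bar>\<close>. The map \<open>F\<close> is \<open>f\<close> in the disc, its continuous boundary
  function on the circle, and \<open>F (1 / cnj \<zeta>) = f \<zeta> + h \<zeta> * \<zeta>\<close> outside. It lifts the point \<open>\<zeta>\<close> along the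
  expanding chain \<open>f\<^sub>t \<zeta> = f \<zeta> + t * \<zeta>\<close> up to the time \<open>t = h \<zeta>\<close>.

  Dilatation. With \<open>M = - \<zeta> * (\<partial>h/\<partial>\<zeta>)\<close> the Wirtinger derivatives of \<open>F\<close> at \<open>1 / cnj \<zeta>\<close> have moduli
  \<open>\<bar>\<zeta>\<bar>^2 * \<bar>M\<bar>\<close> and \<open>\<bar>\<zeta>\<bar>^2 * \<bar>f' + h - M\<bar>\<close>. If \<open>\<gamma> = 0\<close>, then \<open>f\<close> and \<open>F\<close> are the identity.
  Otherwise the power \<open>f'^(1/\<gamma>)\<close> maps the disc into the right half-plane, and the Schwarz-Pick inequality gives
  \<open>\<bar>f''/f'\<bar> \<le> 2 * \<gamma> * cos (arg f' / \<gamma>) / (1 - \<bar>\<zeta>\<bar>^2)\<close>. Hence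
  \<open>\<bar>f' + h - M\<bar> \<le> sin \<alpha> * \<bar>M\<bar>\<close> becomes an elementary inequality in \<open>arg f'\<close> and \<open>\<bar>\<zeta>\<bar>\<close>
  (\<open>dilatation_inequality\<close>). Its core, \<open>chord_add_cos_le\<close>, is an equality at \<open>arg f' = \<alpha>\<close>; this forces the
  factor \<open>1 / cos \<alpha>\<close> in \<open>h\<close>.

  Injectivity. Since \<open>Re f' > 0\<close>, every \<open>f\<^sub>t\<close> is injective and the image of the disc under \<open>f\<^sub>t\<close> increases
  with \<open>t\<close>. A point \<open>w = f\<^sub>s \<zeta>\<close> therefore has a trajectory \<open>\<zeta>\<^sub>t\<close>, \<open>t \<ge> s\<close>, with \<open>f\<^sub>t \<zeta>\<^sub>t = w\<close>. A point
  \<open>1 / cnj \<zeta>\<close> of the exterior is mapped to \<open>w\<close> precisely when \<open>\<zeta> = \<zeta>\<^sub>t\<close> with \<open>t = h \<zeta>\<close>. The dilatation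
  estimate makes the derivative of \<open>h \<zeta>\<^sub>t - t\<close> positive at each of its zeros, so there is at most one
  such time, and none if \<open>w\<close> lies in the image of the disc (\<open>height_crosses_upwards\<close>). Invariance of
  domain takes care of the circle, and makes the proper map \<open>F\<close> surjective with continuous inverse.

  Distributional derivatives. The boundary values of \<open>f'\<close> need not exist, but \<open>\<bar>f'\<bar>\<close> grows at most like
  \<open>(1 - \<bar>\<zeta>\<bar>)^(-\<gamma>)\<close>. So the classical derivatives of \<open>F\<close> off the circle are locally integrable, and as
  \<open>F\<close> is continuous and lines meet the circle in at most two points, the fundamental theorem of
  calculus on lines and Fubini's theorem identify them with the distributional derivatives
  (\<open>distributional_derivatives_off_thin_set\<close>).
\<close>

section \<open>The inequality behind the dilatation bound\<close>

text \<open>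
  The quotient of \<open>sin (d * x)\<close> by \<open>sin x\<close> increases on \<open>(0, pi/2]\<close>: the numerator \<open>N\<close> of its derivative
  vanishes at 0 and has the derivative \<open>(1 - d\<^sup>2) * sin (d * x) * sin x\<close>.
\<close>

lemma sin_mult_le:
  fixes d t :: real
  assumes "0 \<le> d" "d \<le> 1" "0 \<le> t" "t \<le> pi / 2"
  shows "sin (d * t) \<le> sin (d * pi / 2) * sin t"
proof (cases "t = 0")
  case False
  define N where "N = (\<lambda>x. d * cos (d * x) * sin x - sin (d * x) * cos x)"
  have N_nonneg: "0 \<le> N x" if "0 \<le> x" "x \<le> pi / 2" for x
  proof -
    have "N 0 \<le> N x"
    proof (rule DERIV_nonneg_imp_nondecreasing[OF \<open>0 \<le> x\<close>])
      fix y assume y: "0 \<le> y" "y \<le> x"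
      have "(N has_real_derivative (1 - d\<^sup>2) * (sin (d * y) * sin y)) (at y)"
        unfolding N_def by (auto intro!: derivative_eq_intros simp: algebra_simps power2_eq_square)
      moreover have "0 \<le> (1 - d\<^sup>2) * (sin (d * y) * sin y)"
      proof -
        have "0 \<le> d * y" "d * y \<le> y" using y assms by (auto intro: mult_left_le_one_le)
        moreover have "y \<le> pi" using y that pi_gt_zero by linarith
        ultimately have "0 \<le> sin (d * y)" "0 \<le> sin y"
          using y by (auto intro!: sin_ge_zero)
        moreover have "d\<^sup>2 \<le> 1" using assms by (simp add: power_le_one)
        ultimately show ?thesis by simp
      qed
      ultimately show "\<exists>D. (N has_real_derivative D) (at y) \<and> 0 \<le> D" by blast
    qed
    then show ?thesis by (simp add: N_def)
  qed
  have "sin (d * t) / sin t \<le> sin (d * (pi / 2)) / sin (pi / 2)"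
  proof (rule DERIV_nonneg_imp_nondecreasing[OF assms(4)])
    fix x assume x: "t \<le> x" "x \<le> pi / 2"
    have "sin x > 0" using x False assms pi_gt_zero by (intro sin_gt_zero) linarith+
    then have "((\<lambda>x. sin (d * x) / sin x) has_real_derivative N x / (sin x)\<^sup>2) (at x)"
      unfolding N_def by (auto intro!: derivative_eq_intros simp: power2_eq_square field_simps)
    moreover have "0 \<le> N x / (sin x)\<^sup>2" using N_nonneg[of x] x assms by simp
    ultimately show "\<exists>D. ((\<lambda>x. sin (d * x) / sin x) has_real_derivative D) (at x) \<and> 0 \<le> D"
      by blast
  qed
  moreover have "sin t > 0" using False assms pi_gt_zero by (intro sin_gt_zero) linarith+
  ultimately show ?thesis by (simp add: field_simps)
qed simp

text \<open>
  In the triangle with vertices \<open>0\<close>, \<open>c\<close> and \<open>cis t\<close> the square root \<open>D\<close> is the length of the side from \<open>c\<close> to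
  \<open>cis t\<close>. By the law of sines \<open>sin t = D * sin \<psi>\<close>, where \<open>\<psi>\<close> is the angle of that side with the real
  axis, so the claim compares \<open>\<psi>\<close> with \<open>t / \<gamma>\<close>; they agree at both ends of the range of \<open>t\<close>.
  With \<open>p = t / \<gamma>\<close>, the quadratic \<open>z\<^sup>2 - 2 * z * sin p * cos t + (sin p)\<^sup>2\<close> is \<open>(sin t)\<^sup>2\<close> at \<open>z = sin (p - t)\<close> and
  \<open>(D * sin p)\<^sup>2\<close> at \<open>z = c * sin p\<close>. It decreases up to \<open>sin p * cos t\<close>, and \<open>sin_mult_le\<close> orders the two points.
\<close>

lemma chord_mult_sin_le:
  fixes \<gamma> t :: real
  defines "c \<equiv> cos (\<gamma> * pi / 2)"
  assumes "0 < \<gamma>" "\<gamma> < 1" "0 \<le> t" "t \<le> \<gamma> * pi / 2"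
  shows "sqrt (1 + c\<^sup>2 - 2 * c * cos t) * sin (t / \<gamma>) \<le> sin t"
proof -
  define p where "p = t / \<gamma>"
  have p: "0 \<le> p" "p \<le> pi / 2" "t = \<gamma> * p"
    using assms by (auto simp: p_def field_simps)
  have tpi: "t \<le> pi / 2"
  proof -
    have "\<gamma> * pi / 2 \<le> 1 * pi / 2" using assms by (intro divide_right_mono mult_right_mono) auto
    then show ?thesis using assms by linarith
  qed
  have c: "c = sin ((1 - \<gamma>) * pi / 2)"
    unfolding c_def by (simp add: cos_sin_eq algebra_simps diff_divide_distrib)
  have sp: "0 \<le> sin p" using p pi_gt_zero by (intro sin_ge_zero) linarith+
  define z where "z = c * sin p"
  define z0 where "z0 = sin (p - t)"
  have "z0 \<le> z"
    using sin_mult_le[of "1 - \<gamma>" p] assms p by (simp add: z_def z0_def c algebra_simps)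
  moreover have "c \<le> cos t"
    unfolding c_def using assms pi_gt_zero tpi by (intro cos_monotone_0_pi_le) auto
  then have "z \<le> sin p * cos t" using sp unfolding z_def by (metis mult.commute mult_left_mono)
  ultimately have "0 \<le> (z - z0) * (2 * sin p * cos t - z - z0)"
    by (intro mult_nonneg_nonneg) auto
  then have "z\<^sup>2 - 2 * z * sin p * cos t \<le> z0\<^sup>2 - 2 * z0 * sin p * cos t"
    by (simp add: algebra_simps power2_eq_square)
  moreover have "z0\<^sup>2 - 2 * z0 * sin p * cos t + (sin p)\<^sup>2 = (sin t)\<^sup>2"
  proof -
    have "z0\<^sup>2 - 2 * z0 * sin p * cos t + (sin p)\<^sup>2
        = (sin t)\<^sup>2 * (cos p)\<^sup>2 + (sin p)\<^sup>2 * (1 - (cos t)\<^sup>2)"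
      unfolding z0_def sin_diff by (simp add: algebra_simps power2_eq_square)
    also have "\<dots> = (sin t)\<^sup>2 * ((sin p)\<^sup>2 + (cos p)\<^sup>2)"
      unfolding distrib_left sin_squared_eq[of t] by simp
    finally show ?thesis by simp
  qed
  ultimately have "(1 + c\<^sup>2 - 2 * c * cos t) * (sin p)\<^sup>2 \<le> (sin t)\<^sup>2"
    unfolding z_def by (simp add: algebra_simps power2_eq_square)
  then have "sqrt ((1 + c\<^sup>2 - 2 * c * cos t) * (sin p)\<^sup>2) \<le> sqrt ((sin t)\<^sup>2)"
    by (rule real_sqrt_le_mono)
  moreover have "0 \<le> sin t" using assms tpi pi_gt_zero by (intro sin_ge_zero) linarith+
  ultimately show ?thesis using sp by (simp add: real_sqrt_mult p_def)
qed

text \<open>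
  Both sides agree at \<open>t = \<gamma> * pi / 2\<close>, and \<open>chord_mult_sin_le\<close> says that the left side
  has a nonnegative derivative up to there.
\<close>

lemma chord_add_cos_le:
  fixes \<gamma> t :: real
  defines "c \<equiv> cos (\<gamma> * pi / 2)"
  assumes "0 < \<gamma>" "\<gamma> < 1" "0 \<le> t" "t \<le> \<gamma> * pi / 2"
  shows "sqrt (1 + c\<^sup>2 - 2 * c * cos t) + c * (\<gamma> * cos (t / \<gamma>)) \<le> sin (\<gamma> * pi / 2)"
proof -
  define \<Theta> where "\<Theta> = (\<lambda>x. sqrt (1 + c\<^sup>2 - 2 * c * cos x) + c * (\<gamma> * cos (x / \<gamma>)))"
  have g: "0 < \<gamma> * pi / 2" "\<gamma> * pi / 2 < pi / 2" using assms by auto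
  have "0 < c"
    unfolding c_def by (rule cos_gt_zero_pi) (use g in linarith)+
  moreover have "c < 1"
    unfolding c_def using cos_monotone_0_pi[of 0 "\<gamma> * pi / 2"] g by simp
  ultimately have c: "0 < c" "c < 1" by auto
  have "\<Theta> t \<le> \<Theta> (\<gamma> * pi / 2)"
  proof (rule DERIV_nonneg_imp_nondecreasing[OF assms(5)])
    fix x assume x: "t \<le> x" "x \<le> \<gamma> * pi / 2"
    define D where "D = sqrt (1 + c\<^sup>2 - 2 * c * cos x)"
    have "2 * c * cos x \<le> 2 * c * 1" using c by (intro mult_left_mono) auto
    then have "(1 - c)\<^sup>2 \<le> 1 + c\<^sup>2 - 2 * c * cos x"
      by (simp add: power2_eq_square algebra_simps)
    moreover have "0 < (1 - c)\<^sup>2" using c by simp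
    ultimately have pos: "0 < 1 + c\<^sup>2 - 2 * c * cos x" by linarith
    then have "0 < D" by (simp add: D_def)
    have "(\<Theta> has_real_derivative c * sin x / D - c * sin (x / \<gamma>)) (at x)"
      unfolding \<Theta>_def D_def using pos assms
      by (auto intro!: derivative_eq_intros simp: field_simps)
    moreover have "D * sin (x / \<gamma>) \<le> sin x"
      using chord_mult_sin_le[of \<gamma> x] assms x unfolding D_def c_def by auto
    then have "0 \<le> c * sin x / D - c * sin (x / \<gamma>)"
      using \<open>0 < D\<close> c by (simp add: field_simps)
    ultimately show "\<exists>D. (\<Theta> has_real_derivative D) (at x) \<and> 0 \<le> D" by blast
  qed
  also have "\<Theta> (\<gamma> * pi / 2) = sqrt (1 - c\<^sup>2)"
    unfolding \<Theta>_def using assms by (simp add: power2_eq_square c_def[symmetric])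
  also have "\<dots> = sin (\<gamma> * pi / 2)"
    unfolding c_def using g by (simp add: sin_squared_eq[symmetric] sin_ge_zero)
  finally show ?thesis by (simp add: \<Theta>_def)
qed

text \<open>
  The right side minus the left side is a quadratic in \<open>D\<close>. For small \<open>s\<close> it is nonnegative throughout; otherwise it
  increases for \<open>D \<ge> 1 - c\<close>, and its value at \<open>D = 1 - c\<close> is \<open>(1 - c) * (1 - s) * (1 + c - s)\<close>.
\<close>

lemma disc_inequality_real:
  fixes s c D :: real
  assumes "s\<^sup>2 + c\<^sup>2 = 1" "0 \<le> s" "0 < c" "1 - c \<le> D" "D \<le> s"
  shows "(s - D) * (s\<^sup>2 + D) \<le> c * (s\<^sup>2 + D\<^sup>2)"
proof -
  have c1: "c \<le> 1" using assms(1,3) by (metis abs_le_square_iff abs_of_pos add.commute le_add_same_cancel1 one_power2 abs_one zero_le_power2)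
  have s1: "s \<le> 1" using assms(1,2) by (metis abs_le_square_iff abs_of_nonneg le_add_same_cancel1 one_power2 abs_one zero_le_power2)
  have s2: "s\<^sup>2 = (1 - c) * (1 + c)" using assms(1) by (simp add: algebra_simps power2_eq_square)
  have c2: "c\<^sup>2 = (1 - s) * (1 + s)" using assms(1) by (simp add: algebra_simps power2_eq_square)
  have expand: "c * (s\<^sup>2 + D\<^sup>2) - (s - D) * (s\<^sup>2 + D)
      = (1 + c) * D\<^sup>2 - s * (1 - s) * D + s\<^sup>2 * (c - s)"
    by (simp add: algebra_simps power2_eq_square)
  show ?thesis
  proof (cases "s \<le> 1/3")
    case True
    have "s\<^sup>2 \<le> (1/3)\<^sup>2" using True assms by (intro power_mono) auto
    then have "(9/10)\<^sup>2 \<le> c\<^sup>2" using assms(1) by (simp add: power2_eq_square)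
    then have c9: "9/10 \<le> c" using assms(3) power2_le_imp_le[of "9/10" c] by linarith
    have "s * (1 - s) * D \<le> s * D"
      using assms True c1 by (intro mult_right_mono) (auto simp: algebra_simps)
    moreover have "0 \<le> (D - s / 2)\<^sup>2" by simp
    then have "s * D \<le> D\<^sup>2 + s\<^sup>2 * (1/4)" by (simp add: algebra_simps power2_eq_square)
    moreover have "s\<^sup>2 * (1/4) \<le> s\<^sup>2 * (c - s)" using True c9 by (intro mult_left_mono) auto
    moreover have "D\<^sup>2 \<le> (1 + c) * D\<^sup>2" using assms by (simp add: algebra_simps)
    ultimately show ?thesis using expand by linarith
  next
    case False
    define d where "d = D - (1 - c)"
    have "(1 + c) * D\<^sup>2 - s * (1 - s) * D + s\<^sup>2 * (c - s)
      = (c * (s\<^sup>2 + (1 - c)\<^sup>2) - (s - (1 - c)) * (s\<^sup>2 + (1 - c)))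
        + d * (2 * ((1 - c) * (1 + c)) - s * (1 - s)) + (1 + c) * d\<^sup>2"
      by (simp add: d_def algebra_simps power2_eq_square)
    moreover have "s\<^sup>2 + (1 - c)\<^sup>2 = 2 * (1 - c)"
      using assms(1) by (simp add: algebra_simps power2_eq_square)
    moreover have "s\<^sup>2 + (1 - c) = (1 - c) * (2 + c)" using s2 by (simp add: algebra_simps)
    moreover have "0 \<le> c * (2 * (1 - c)) - (s - (1 - c)) * ((1 - c) * (2 + c))"
    proof -
      have "2 * c - (s - (1 - c)) * (2 + c) = (1 - s) * (2 + c) - c\<^sup>2"
        by (simp add: algebra_simps power2_eq_square)
      also have "\<dots> = (1 - s) * ((1 + c) - s)" unfolding c2 by (simp add: algebra_simps)
      finally have "0 \<le> 2 * c - (s - (1 - c)) * (2 + c)" using s1 assms(3) by simp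
      then have "0 \<le> (1 - c) * (2 * c - (s - (1 - c)) * (2 + c))" using c1 by simp
      then show ?thesis by (simp add: algebra_simps)
    qed
    moreover have "0 \<le> d * (2 * ((1 - c) * (1 + c)) - s * (1 - s))"
    proof -
      have "2 * s\<^sup>2 - s * (1 - s) = s * (3 * s - 1)" by (simp add: algebra_simps power2_eq_square)
      then have "0 \<le> 2 * s\<^sup>2 - s * (1 - s)" using False by simp
      then show ?thesis using s2 assms(4) by (simp add: d_def)
    qed
    moreover have "0 \<le> (1 + c) * d\<^sup>2" using assms by simp
    ultimately show ?thesis using expand by simp
  qed
qed

text \<open>
  Let \<open>G q\<close> be the difference of the squares of both sides. For \<open>q = 1\<close> the claim says that the disc of
  radius \<open>n\<close> lies in the Apollonius disc \<open>\<bar>p + W\<bar> \<le> s * \<bar>1 + W\<bar>\<close>; comparing centres and radii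
  turns this into \<open>D + c * n \<le> s\<close>. The step from 1 to \<open>q\<close> is \<open>G q \<ge> q\<^sup>2 * G 1\<close>, which comes down to
  \<open>n * (s\<^sup>2 + D) \<le> s\<^sup>2 + D\<^sup>2\<close> and so to \<open>disc_inequality_real\<close>.
\<close>

lemma disc_inequality:
  fixes s c D n q :: real and p W :: complex
  assumes sc: "s\<^sup>2 + c\<^sup>2 = 1" "0 \<le> s" "0 < c"
    and p: "cmod p = D" "2 * Re p = s\<^sup>2 + D\<^sup>2" "1 - c \<le> D"
    and n: "D + c * n \<le> s" "n \<le> 1" "cmod W \<le> n" and q: "1 \<le> q"
  shows "cmod (p + q * W) \<le> s * q * cmod (q + W)"
proof -
  have n0: "0 \<le> n" using n(3) norm_ge_zero order_trans by blast
  have D0: "0 \<le> D" using p(1) norm_ge_zero by blast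
  have Ds: "D \<le> s" using n(1) n0 sc(3) by (smt (verit) mult_nonneg_nonneg)
  define v b where "v = Re W" and "b = Re (cnj p * W)"
  have J: "n * (s\<^sup>2 + D) \<le> s\<^sup>2 + D\<^sup>2"
  proof -
    have "(c * n) * (s\<^sup>2 + D) \<le> (s - D) * (s\<^sup>2 + D)"
      using n(1) D0 by (intro mult_right_mono) auto
    also have "\<dots> \<le> c * (s\<^sup>2 + D\<^sup>2)" by (rule disc_inequality_real) (use sc p Ds in auto)
    finally show ?thesis using sc(3) by simp
  qed
  define G where "G = (\<lambda>q. s\<^sup>2 * q^4 + 2 * s\<^sup>2 * v * q^3 - c\<^sup>2 * (cmod W)\<^sup>2 * q\<^sup>2 - 2 * b * q - D\<^sup>2)"
  have G: "(s * q * cmod (q + W))\<^sup>2 - (cmod (p + q * W))\<^sup>2 = G q"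
  proof -
    have c2: "c\<^sup>2 = 1 - s\<^sup>2" using sc(1) by simp
    have D2: "D\<^sup>2 = (Re p)\<^sup>2 + (Im p)\<^sup>2" using p(1) cmod_power2[of p] by simp
    show ?thesis unfolding G_def c2 D2 v_def b_def power_mult_distrib cmod_power2
      by (simp add: algebra_simps power2_eq_square power3_eq_cube power4_eq_xxxx)
  qed
  have G1: "0 \<le> G 1"
  proof -
    have "(cmod (cnj p - s\<^sup>2))\<^sup>2 = (c * D)\<^sup>2"
    proof -
      have "(cmod (cnj p - s\<^sup>2))\<^sup>2 = (Re p)\<^sup>2 + (Im p)\<^sup>2 - s\<^sup>2 * (2 * Re p) + s\<^sup>2 * s\<^sup>2"
        unfolding cmod_power2 by (simp add: algebra_simps power2_eq_square)
      also have "\<dots> = D\<^sup>2 * (1 - s\<^sup>2)"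
        using p(1) cmod_power2[of p] unfolding p(2) by (simp add: algebra_simps)
      also have "1 - s\<^sup>2 = c\<^sup>2" using sc(1) by simp
      finally show ?thesis by (simp add: power_mult_distrib)
    qed
    then have cD: "cmod (cnj p - s\<^sup>2) = c * D" using sc(3) D0 by simp
    have "b - s\<^sup>2 * v = Re ((cnj p - s\<^sup>2) * W)" by (simp add: b_def v_def algebra_simps)
    also have "\<dots> \<le> cmod ((cnj p - s\<^sup>2) * W)" by (rule complex_Re_le_cmod)
    also have "\<dots> = c * D * cmod W" by (simp only: norm_mult cD)
    also have "\<dots> \<le> c * D * n" using n sc D0 by (intro mult_left_mono) auto
    finally have "b - s\<^sup>2 * v \<le> c * D * n" .
    moreover have "c\<^sup>2 * (cmod W)\<^sup>2 \<le> c\<^sup>2 * n\<^sup>2" using n by (intro mult_left_mono power_mono) auto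
    moreover have "(D + c * n)\<^sup>2 \<le> s\<^sup>2" using n n0 D0 sc by (intro power_mono) auto
    ultimately show ?thesis unfolding G_def by (simp add: algebra_simps power2_eq_square)
  qed
  have "G q - q\<^sup>2 * G 1 = (q - 1) * ((q + 1) * (s\<^sup>2 * q\<^sup>2 + D\<^sup>2) + 2 * q * (s\<^sup>2 * v * q + b))"
    unfolding G_def by (simp add: algebra_simps power2_eq_square power3_eq_cube power4_eq_xxxx)
  moreover have "0 \<le> (q + 1) * (s\<^sup>2 * q\<^sup>2 + D\<^sup>2) + 2 * q * (s\<^sup>2 * v * q + b)"
  proof -
    have "- (s\<^sup>2 * v * q + b) = - Re ((s\<^sup>2 * q + cnj p) * W)"
      by (simp add: b_def v_def algebra_simps)
    also have "\<dots> \<le> cmod ((s\<^sup>2 * q + cnj p) * W)" using abs_Re_le_cmod by (smt (verit))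
    also have "\<dots> \<le> (s\<^sup>2 * q + D) * n"
    proof -
      have "cmod (s\<^sup>2 * q + cnj p) \<le> cmod (of_real (s\<^sup>2 * q)) + cmod (cnj p)"
        using norm_triangle_ineq[of "of_real (s\<^sup>2 * q)" "cnj p"] by simp
      also have "\<dots> = s\<^sup>2 * q + D" using p(1) q by (simp add: norm_mult norm_power)
      finally show ?thesis unfolding norm_mult using n D0 q
        by (intro mult_mono) auto
    qed
    finally have "2 * q * (- (s\<^sup>2 * v * q + b)) \<le> 2 * q * ((s\<^sup>2 * q + D) * n)"
      using q by (intro mult_left_mono) auto
    moreover have "2 * q * ((s\<^sup>2 * q + D) * n) \<le> (q + 1) * (s\<^sup>2 * q\<^sup>2 + D\<^sup>2)"
    proof -
      have "(q + 1) * (s\<^sup>2 * q\<^sup>2 + D\<^sup>2) - 2 * q * ((s\<^sup>2 * q + D) * n)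
         = 2 * q * (s\<^sup>2 + D\<^sup>2 - n * (s\<^sup>2 + D)) +
           (q - 1) * ((s\<^sup>2 * q\<^sup>2 - D\<^sup>2) + 2 * s\<^sup>2 * q * (1 - n))"
        by (simp add: algebra_simps power2_eq_square)
      moreover have "0 \<le> 2 * q * (s\<^sup>2 + D\<^sup>2 - n * (s\<^sup>2 + D))" using J q by simp
      moreover have "D\<^sup>2 \<le> (s * q)\<^sup>2"
      proof (rule power_mono)
        have "s * 1 \<le> s * q" using q sc by (intro mult_left_mono) auto
        then show "D \<le> s * q" using Ds by simp
      qed (rule D0)
      then have "0 \<le> (q - 1) * ((s\<^sup>2 * q\<^sup>2 - D\<^sup>2) + 2 * s\<^sup>2 * q * (1 - n))"
        using q n by (intro mult_nonneg_nonneg add_nonneg_nonneg) (auto simp: power_mult_distrib)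
      ultimately show ?thesis by linarith
    qed
    ultimately show ?thesis by linarith
  qed
  ultimately have "0 \<le> G q - q\<^sup>2 * G 1" using q by simp
  moreover have "0 \<le> q\<^sup>2 * G 1" using G1 by simp
  ultimately have "0 \<le> G q" by linarith
  then have "(cmod (p + q * W))\<^sup>2 \<le> (s * q * cmod (q + W))\<^sup>2" using G by linarith
  then show ?thesis by (rule power2_le_imp_le) (use sc q in auto)
qed

text \<open>
  In the application \<open>t\<close> is the argument of \<open>f' \<zeta>\<close>, \<open>q = 1 / \<bar>\<zeta>\<bar>\<close>, and \<open>W\<close> is a multiple of \<open>\<zeta> * f'' \<zeta> / f' \<zeta>\<close>, whose
  size is controlled by the Schwarz-Pick inequality. The distance of \<open>c * cis t\<close> from 1 equals the
  distance of \<open>c\<close> from \<open>cis t\<close>, so \<open>chord_add_cos_le\<close> supplies the hypothesis of \<open>disc_inequality\<close>.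
\<close>

lemma dilatation_inequality:
  fixes \<gamma> t q :: real and W :: complex
  defines "c \<equiv> cos (\<gamma> * pi / 2)" and "s \<equiv> sin (\<gamma> * pi / 2)"
  assumes "0 \<le> \<gamma>" "\<gamma> < 1" "\<bar>t\<bar> \<le> \<gamma> * pi / 2" and W: "cmod W \<le> \<gamma> * cos (t / \<gamma>)" and "1 \<le> q"
  shows "cmod ((1 - c * cis t) + q * W) \<le> s * q * cmod (q + W)"
proof (cases "\<gamma> = 0")
  case True
  then show ?thesis using assms by simp
next
  case False
  then have g: "0 < \<gamma>" using assms by simp
  have a: "0 < \<gamma> * pi / 2" "\<gamma> * pi / 2 < pi / 2" using assms g by auto
  have "0 < c" unfolding c_def by (rule cos_gt_zero_pi) (use a in linarith)+
  moreover have "0 \<le> s" unfolding s_def by (rule sin_ge_zero) (use a in linarith)+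
  ultimately have c: "0 < c" "c \<le> 1" and s: "0 \<le> s" by (auto simp: c_def)
  have sc: "s\<^sup>2 + c\<^sup>2 = 1" by (simp add: s_def c_def)
  define D where "D = sqrt (1 + c\<^sup>2 - 2 * c * cos t)"
  have sq: "(cmod (1 - c * cis t))\<^sup>2 = 1 + c\<^sup>2 - 2 * c * cos t"
  proof -
    have "(cmod (1 - c * cis t))\<^sup>2 = 1 - 2 * c * cos t + c\<^sup>2 * ((sin t)\<^sup>2 + (cos t)\<^sup>2)"
      unfolding cmod_power2 by (simp add: algebra_simps power2_eq_square del: sin_cos_squared_add sin_cos_squared_add2 sin_cos_squared_add3)
    then show ?thesis by simp
  qed
  then have pD: "cmod (1 - c * cis t) = D" by (metis D_def norm_ge_zero real_sqrt_unique)
  have D2: "D\<^sup>2 = 1 + c\<^sup>2 - 2 * c * cos t" using sq pD by simp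
  have Re: "2 * Re (1 - c * cis t) = s\<^sup>2 + D\<^sup>2" using D2 sc by simp
  have "c * cos t \<le> c * 1" using c by (intro mult_left_mono) auto
  then have "(1 - c)\<^sup>2 \<le> D\<^sup>2" unfolding D2 by (simp add: algebra_simps power2_eq_square)
  then have Dc: "1 - c \<le> D" using pD by (metis norm_ge_zero power2_le_imp_le)
  have "cos (\<bar>t\<bar> / \<gamma>) = cos (t / \<gamma>)" using g by (metis abs_div_pos cos_abs_real)
  then have H: "D + c * (\<gamma> * cos (t / \<gamma>)) \<le> s"
    using chord_add_cos_le[of \<gamma> "\<bar>t\<bar>"] g assms unfolding D_def c_def s_def by simp
  have "\<gamma> * cos (t / \<gamma>) \<le> \<gamma> * 1" using g by (intro mult_left_mono) auto
  then have "\<gamma> * cos (t / \<gamma>) \<le> 1" using assms by simp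
  then show ?thesis using disc_inequality[OF sc s c(1) pD Re Dc H _ W \<open>1 \<le> q\<close>] by simp
qed

section \<open>Maps into the right half-plane and into a sector\<close>

lemma cmod_diff_less_cmod_add_cnj:
  assumes "0 < Re w" "0 < Re a"
  shows "cmod (w - a) < cmod (w + cnj a)"
proof -
  have "(cmod (w + cnj a))\<^sup>2 - (cmod (w - a))\<^sup>2 = 4 * Re w * Re a"
    unfolding cmod_power2 by (simp add: algebra_simps power2_eq_square)
  then have "(cmod (w - a))\<^sup>2 < (cmod (w + cnj a))\<^sup>2" using mult_pos_pos[OF assms] by linarith
  then show ?thesis by (rule power2_less_imp_less) simp
qed

text \<open>
  The Schwarz lemma for the Cayley transform \<open>(g - 1) / (g + 1)\<close>.
\<close>

lemma right_half_plane_growth: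
  assumes g: "g holomorphic_on ball 0 1" "g 0 = 1" "\<And>z. z \<in> ball 0 1 \<Longrightarrow> 0 < Re (g z)"
    and z: "z \<in> ball 0 1"
  shows "cmod (g z) \<le> (1 + cmod z) / (1 - cmod z)"
proof -
  define u where "u = (\<lambda>z. (g z - 1) / (g z + 1))"
  have nz: "g w + 1 \<noteq> 0" if "w \<in> ball 0 1" for w
    using g(3)[OF that] by (auto simp: complex_eq_iff)
  have "cmod (u z) \<le> cmod z"
  proof (rule Schwarz_Lemma(1))
    show "u holomorphic_on ball 0 1" unfolding u_def using g(1) nz by (intro holomorphic_intros) auto
    show "cmod (u w) < 1" if "cmod w < 1" for w
      using cmod_diff_less_cmod_add_cnj[of "g w" 1] g(3)[of w] nz[of w] that
      by (simp add: u_def norm_divide)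
  qed (use g z in \<open>auto simp: u_def\<close>)
  then have "cmod (g z - 1) \<le> cmod z * cmod (g z + 1)"
    using nz[OF z] by (simp add: u_def norm_divide divide_le_eq)
  also have "\<dots> \<le> cmod z * (cmod (g z) + 1)"
    using norm_triangle_ineq[of "g z" 1] by (intro mult_left_mono) auto
  finally have "cmod (g z) * (1 - cmod z) \<le> 1 + cmod z"
    using norm_triangle_ineq2[of "g z" 1] by (simp add: algebra_simps)
  then show ?thesis using z by (simp add: pos_le_divide_eq)
qed

text \<open>
  The Schwarz lemma for \<open>g\<close> composed with the disc automorphism that moves 0 to \<open>z\<close> and with the Cayley
  transform that sends \<open>g z\<close> to 0.
\<close>

lemma right_half_plane_Schwarz_Pick:
  assumes g: "g holomorphic_on ball 0 1" "\<And>z. z \<in> ball 0 1 \<Longrightarrow> 0 < Re (g z)"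
    and z: "z \<in> ball 0 1"
  shows "cmod (deriv g z) \<le> 2 * Re (g z) / (1 - (cmod z)\<^sup>2)"
proof -
  define m where "m = Moebius_function 0 (- z)"
  define u where "u = (\<lambda>w. (g (m w) - g z) / (g (m w) + cnj (g z)))"
  have z1: "cmod z < 1" using z by simp
  have m0: "m 0 = z" by (simp add: m_def Moebius_function_of_zero)
  have m_hol: "m holomorphic_on ball 0 1"
    unfolding m_def using z1 by (intro Moebius_function_holomorphic) simp
  have m_ball: "m w \<in> ball 0 1" if "w \<in> ball 0 1" for w
    unfolding m_def using Moebius_function_norm_lt_1[of "- z" w 0] that z1 by simp
  have nz: "g w + cnj (g z) \<noteq> 0" if "w \<in> ball 0 1" for w
    using g(2)[OF that] g(2)[OF z] by (auto simp: complex_eq_iff)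
  have gm: "(\<lambda>w. g (m w)) holomorphic_on ball 0 1"
    using holomorphic_on_compose_gen[OF m_hol g(1)] image_subsetI[of "ball 0 1" m, OF m_ball]
    by (simp add: o_def)
  have "cmod (deriv u 0) \<le> 1"
  proof (rule Schwarz_Lemma(2)[where \<xi> = 0])
    show "u holomorphic_on ball 0 1"
      unfolding u_def using gm nz m_ball by (intro holomorphic_intros) auto
    show "cmod (u w) < 1" if "cmod w < 1" for w
      using cmod_diff_less_cmod_add_cnj[of "g (m w)" "g z"] g(2)[OF m_ball, of w] g(2)[OF z]
        nz[OF m_ball, of w] that
      by (simp add: u_def norm_divide)
  qed (auto simp: u_def m0)
  moreover have "deriv u 0 = deriv g z * (1 - (cmod z)\<^sup>2) / (2 * Re (g z))"
  proof -
    have "(m has_field_derivative (1 - (cmod z)\<^sup>2)) (at 0)"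
      unfolding m_def Moebius_function_simple[abs_def]
      by (auto intro!: derivative_eq_intros simp: complex_norm_square[symmetric] mult.commute[of "cnj z"])
    moreover have "(g has_field_derivative deriv g z) (at (m 0))"
      using holomorphic_derivI[OF g(1) _ z] m0 by simp
    ultimately have d: "((\<lambda>w. g (m w)) has_field_derivative deriv g z * (1 - (cmod z)\<^sup>2)) (at 0)"
      using DERIV_chain2 by blast
    have "(u has_field_derivative deriv g z * (1 - (cmod z)\<^sup>2) / (g z + cnj (g z))) (at 0)"
      unfolding u_def using nz[OF z] by (auto intro!: derivative_eq_intros d simp: m0)
    then show ?thesis by (simp add: DERIV_imp_deriv complex_add_cnj)
  qed
  moreover have "0 < 1 - (cmod z)\<^sup>2" using z1 by (simp add: power_less_one_iff)
  ultimately have "cmod (deriv g z) * (1 - (cmod z)\<^sup>2) / (2 * Re (g z)) \<le> 1"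
    using g(2)[OF z] by (simp add: norm_mult norm_divide flip: of_real_power of_real_diff)
  then show ?thesis using g(2)[OF z] \<open>0 < 1 - (cmod z)\<^sup>2\<close> by (simp add: field_simps)
qed

text \<open>
  A function that increases through each of its zeros cannot return to zero: at the first zero after a
  positive value it would have to arrive from above.
\<close>

lemma positive_after_upcrossings:
  fixes k :: "real \<Rightarrow> real"
  assumes "a < b" "0 \<le> k a"
    and der: "\<And>t. t \<in> {a..b} \<Longrightarrow> \<exists>d. (k has_real_derivative d) (at t within {a..b}) \<and> (k t = 0 \<longrightarrow> 0 < d)"
  shows "0 < k b"
proof (rule ccontr)
  assume kb: "\<not> 0 < k b"
  have cont: "continuous_on {a..b} k"
    using der by (meson DERIV_continuous continuous_on_eq_continuous_within)
  obtain c where c: "c \<in> {a..b}" "0 < k c"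
  proof (cases "k a = 0")
    case True
    then obtain d where "(k has_real_derivative d) (at a within {a..b})" "0 < d"
      using der[of a] \<open>a < b\<close> by auto
    then obtain e where e: "0 < e" "\<And>h. 0 < h \<Longrightarrow> a + h \<in> {a..b} \<Longrightarrow> h < e \<Longrightarrow> k a < k (a + h)"
      using has_real_derivative_pos_inc_right by blast
    show ?thesis
      using e(2)[of "min (e/2) (b - a)"] e(1) \<open>a < b\<close> True
      by (intro that[of "a + min (e/2) (b - a)"]) auto
  next
    case False
    then show ?thesis using that[of a] assms by auto
  qed
  define S where "S = {t \<in> {c..b}. k t \<in> {..0}}"
  have S: "S = {c..b} \<inter> k -` {..0}" by (auto simp: S_def)
  have "continuous_on {c..b} k" using c by (intro continuous_on_subset[OF cont]) auto
  then have "closed S" unfolding S by (intro continuous_closed_preimage) auto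
  moreover have "bounded S" by (rule bounded_subset[of "{c..b}"]) (auto simp: S_def)
  moreover have "b \<in> S" using kb c by (auto simp: S_def)
  ultimately obtain t where t: "t \<in> S" "\<And>u. u \<in> S \<Longrightarrow> t \<le> u"
    using compact_attains_inf[of S] compact_eq_bounded_closed by blast
  have "c \<le> t" "k t \<le> 0" using t(1) by (auto simp: S_def)
  then have ct: "c < t" using c by (cases "c = t") auto
  have tab: "t \<in> {a..b}" using t(1) c by (auto simp: S_def)
  have pos: "0 < k u" if "c \<le> u" "u < t" for u
    using t(2)[of u] that tab by (force simp: S_def)
  have "k t = 0"
  proof (rule ccontr)
    assume "k t \<noteq> 0"
    then have kt: "k t < 0" using t(1) by (auto simp: S_def)
    have "continuous_on {c..t} k" using tab c by (intro continuous_on_subset[OF cont]) auto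
    then obtain u where "c \<le> u" "u \<le> t" "k u = 0"
      using IVT2'[of k t 0 c] ct kt c by auto
    then show False using pos[of u] kt by (cases "u = t") auto
  qed
  then obtain d where "(k has_real_derivative d) (at t within {a..b})" "0 < d"
    using der[OF tab] by auto
  then obtain e where e: "0 < e" "\<And>h. 0 < h \<Longrightarrow> t - h \<in> {a..b} \<Longrightarrow> h < e \<Longrightarrow> k (t - h) < k t"
    using has_real_derivative_pos_inc_left by blast
  define h where "h = min (e/2) (t - c)"
  have "k (t - h) < k t" using e(1) ct c tab by (intro e(2)) (auto simp: h_def)
  moreover have "0 < k (t - h)" using ct e(1) by (intro pos) (auto simp: h_def)
  ultimately show False using \<open>k t = 0\<close> by simp
qed

locale sector_derivative =
  fixes f :: "complex \<Rightarrow> complex" and \<gamma> :: real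
  assumes hol: "f holomorphic_on ball 0 1"
    and f_0: "f 0 = 0" and deriv_0: "deriv f 0 = 1"
    and gamma: "0 \<le> \<gamma>" "\<gamma> < 1"
    and nonzero: "\<And>z. z \<in> ball 0 1 \<Longrightarrow> deriv f z \<noteq> 0"
    and Arg_le: "\<And>z. z \<in> ball 0 1 \<Longrightarrow> \<bar>Arg (deriv f z)\<bar> \<le> \<gamma> * pi / 2"
begin

lemma alpha: "0 \<le> \<gamma> * pi / 2" "\<gamma> * pi / 2 < pi / 2"
  using gamma by auto

lemma Re_deriv_pos: "0 < Re (deriv f z)" if "z \<in> ball 0 1"
proof -
  have "0 < cos (Arg (deriv f z))"
    using Arg_le[OF that] alpha by (intro cos_gt_zero_pi) linarith+
  then show ?thesis using nonzero[OF that]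
    by (metis Re_rcis mult_pos_pos rcis_cmod_Arg zero_less_norm_iff)
qed

lemma deriv_hol: "deriv f holomorphic_on ball 0 1"
  using hol by (intro holomorphic_deriv) auto

definition log_deriv where "log_deriv z = Ln (deriv f z)"

lemma log_deriv_hol: "log_deriv holomorphic_on ball 0 1"
  unfolding log_deriv_def
proof (intro holomorphic_on_Ln' deriv_hol)
  fix z :: complex assume "z \<in> ball 0 1"
  then show "deriv f z \<notin> \<real>\<^sub>\<le>\<^sub>0" using Re_deriv_pos[of z] by (auto simp: complex_nonpos_Reals_iff)
qed

lemma Im_log_deriv: "Im (log_deriv z) = Arg (deriv f z)" if "z \<in> ball 0 1"
  using nonzero[OF that] by (simp add: log_deriv_def Arg_eq_Im_Ln)

lemma Re_log_deriv: "Re (log_deriv z) = ln (cmod (deriv f z))" if "z \<in> ball 0 1"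
  using nonzero[OF that] by (simp add: log_deriv_def Re_Ln)

lemma deriv_log_deriv: "deriv log_deriv z = deriv (deriv f) z / deriv f z" if "z \<in> ball 0 1"
proof -
  have "(deriv f has_field_derivative deriv (deriv f) z) (at z)"
    using holomorphic_derivI[OF deriv_hol _ that] by simp
  then have "(log_deriv has_field_derivative inverse (deriv f z) * deriv (deriv f) z) (at z)"
    unfolding log_deriv_def
    using Re_deriv_pos[OF that] by (auto intro!: derivative_eq_intros simp: complex_nonpos_Reals_iff)
  then show ?thesis by (simp add: DERIV_imp_deriv field_simps)
qed

lemma nonconstant_image_interior:
  assumes "g holomorphic_on ball 0 1" "\<not> g constant_on ball 0 1" "g ` ball 0 1 \<subseteq> A"
  shows "g ` ball 0 1 \<subseteq> interior A"
  using open_mapping_thm[OF assms(1) _ _ _ _ assms(2), of "ball 0 1"] assms(3)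
  by (simp add: interior_maximal)

text \<open>
  A real-valued holomorphic function is not open, hence constant.
\<close>

lemma log_deriv_constant_if_gamma_0:
  assumes "\<gamma> = 0" "z \<in> ball 0 1"
  shows "log_deriv z = 0"
proof -
  have im: "log_deriv ` ball 0 1 \<subseteq> {w. Im w = 0}"
    using Arg_le assms(1) by (auto simp: Im_log_deriv)
  have "log_deriv constant_on ball 0 1"
  proof (rule ccontr)
    assume "\<not> log_deriv constant_on ball 0 1"
    from nonconstant_image_interior[OF log_deriv_hol this im]
    have "log_deriv 0 \<in> interior {w. Im w = 0}" by (auto simp: image_subset_iff)
    moreover have "interior {w. Im w = 0} = {}"
      using empty_interior_lowdim interior_hyperplane[of "\<i>::complex" 0]
      by (simp add: inner_complex_def)
    ultimately show False by simp
  qed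
  then have "log_deriv z = log_deriv 0"
    using assms(2) unfolding constant_on_def by (metis centre_in_ball zero_less_one)
  then show ?thesis by (simp add: log_deriv_def deriv_0)
qed

text \<open>
  The power \<open>f'^(1/\<gamma>)\<close> opens the sector to the closed right half-plane. The open mapping theorem
  keeps it off the boundary.
\<close>

lemma deriv_power_half_plane:
  assumes "0 < \<gamma>"
  defines "g \<equiv> \<lambda>z. exp (log_deriv z / \<gamma>)"
  shows "g holomorphic_on ball 0 1" "g 0 = 1" "\<And>z. z \<in> ball 0 1 \<Longrightarrow> 0 < Re (g z)"
proof -
  show hg: "g holomorphic_on ball 0 1"
    unfolding g_def using log_deriv_hol assms by (intro holomorphic_intros) auto
  show g0: "g 0 = 1" by (simp add: g_def log_deriv_def deriv_0)
  have "0 \<le> Re (g z)" if "z \<in> ball 0 1" for z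
  proof -
    have "\<bar>Im (log_deriv z / \<gamma>)\<bar> \<le> pi / 2"
      using Arg_le[OF that] assms by (simp add: Im_log_deriv[OF that] field_simps)
    then have "0 \<le> cos (Im (log_deriv z / \<gamma>))" by (intro cos_ge_zero) linarith+
    then show ?thesis by (simp add: g_def Re_exp)
  qed
  then have im: "g ` ball 0 1 \<subseteq> {w. Re w \<ge> 0}" by auto
  fix z :: complex assume z: "z \<in> ball 0 1"
  show "0 < Re (g z)"
  proof (cases "g constant_on ball 0 1")
    case True
    then have "g z = g 0"
      using z unfolding constant_on_def by (metis centre_in_ball zero_less_one)
    then show ?thesis by (simp add: g0)
  next
    case False
    from nonconstant_image_interior[OF hg this im] z
    have "g z \<in> interior {w. Re w \<ge> 0}" by (auto simp: image_subset_iff)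
    also have "interior {w. Re w \<ge> 0} = {w. Re w > 0}"
      using interior_halfspace_ge[of "1::complex" 0] by (simp add: inner_complex_def)
    finally show ?thesis by simp
  qed
qed

text \<open>
  For \<open>g = f'^(1/\<gamma>)\<close> the logarithmic derivative is \<open>f'' / (\<gamma> * f')\<close>, and \<open>Re g / \<bar>g\<bar> = cos (arg f' / \<gamma>)\<close>.
  If \<open>\<gamma> = 0\<close>, both sides are 0, because of the factor \<open>\<gamma>\<close> on the right.
\<close>

lemma pre_Schwarzian_bound:
  assumes z: "z \<in> ball 0 1"
  shows "cmod (deriv (deriv f) z / deriv f z) \<le> 2 * (\<gamma> * cos (Arg (deriv f z) / \<gamma>)) / (1 - (cmod z)\<^sup>2)"
proof (cases "\<gamma> = 0")
  case True
  have "deriv log_deriv z = deriv (\<lambda>_. 0) z"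
    by (rule complex_derivative_transform_within_open[OF log_deriv_hol _ open_ball z])
      (auto simp: log_deriv_constant_if_gamma_0[OF True])
  then show ?thesis using True by (simp add: deriv_log_deriv[OF z])
next
  case False
  then have g0: "0 < \<gamma>" using gamma by simp
  define g where "g = (\<lambda>z. exp (log_deriv z / \<gamma>))"
  have g: "g holomorphic_on ball 0 1" "\<And>z. z \<in> ball 0 1 \<Longrightarrow> 0 < Re (g z)"
    unfolding g_def using deriv_power_half_plane[OF g0] by blast+
  have "(log_deriv has_field_derivative deriv log_deriv z) (at z)"
    using holomorphic_derivI[OF log_deriv_hol _ z] by simp
  then have "(g has_field_derivative g z * (deriv log_deriv z / \<gamma>)) (at z)"
    unfolding g_def using g0 by (auto intro!: derivative_eq_intros)
  then have "deriv g z = g z * (deriv log_deriv z / \<gamma>)" by (rule DERIV_imp_deriv)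
  then have eq: "cmod (deriv g z) = cmod (g z) * cmod (deriv log_deriv z) / \<gamma>"
    using g0 by (simp add: norm_mult norm_divide)
  have Reg: "Re (g z) = cmod (g z) * cos (Arg (deriv f z) / \<gamma>)"
    by (simp add: g_def Re_exp norm_exp_eq_Re Im_log_deriv[OF z])
  have "cmod (g z) * (cmod (deriv log_deriv z) / \<gamma>)
      \<le> cmod (g z) * (2 * cos (Arg (deriv f z) / \<gamma>) / (1 - (cmod z)\<^sup>2))"
    using right_half_plane_Schwarz_Pick[OF g(1) g(2) z] unfolding eq Reg by (simp add: mult_ac)
  moreover have "0 < cmod (g z)" by (simp add: g_def)
  ultimately have "cmod (deriv log_deriv z) / \<gamma> \<le> 2 * cos (Arg (deriv f z) / \<gamma>) / (1 - (cmod z)\<^sup>2)"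
    using mult_le_cancel_left_pos by blast
  then show ?thesis using g0 by (simp add: deriv_log_deriv[OF z] field_simps)
qed

text \<open>
  The bound for \<open>f'^(1/\<gamma>)\<close> from \<open>right_half_plane_growth\<close>, raised to the power \<open>\<gamma>\<close>.
\<close>

lemma deriv_growth:
  assumes z: "z \<in> ball 0 1"
  shows "cmod (deriv f z) \<le> (2 / (1 - cmod z)) powr \<gamma>"
proof (cases "\<gamma> = 0")
  case True
  then have "deriv f z = 1"
    using log_deriv_constant_if_gamma_0[OF True z] nonzero[OF z] unfolding log_deriv_def
    by (metis exp_Ln exp_zero)
  then show ?thesis using z True by simp
next
  case False
  then have g0: "0 < \<gamma>" using gamma by simp
  have z1: "cmod z < 1" using z by simp
  have "cmod (exp (log_deriv z / \<gamma>)) \<le> (1 + cmod z) / (1 - cmod z)"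
    by (rule right_half_plane_growth[OF deriv_power_half_plane[OF g0] z])
  also have "\<dots> \<le> 2 / (1 - cmod z)" using z1 by (intro divide_right_mono) auto
  finally have "exp (Re (log_deriv z) / \<gamma>) \<le> 2 / (1 - cmod z)" by (simp add: norm_exp_eq_Re)
  then have "exp (Re (log_deriv z) / \<gamma>) powr \<gamma> \<le> (2 / (1 - cmod z)) powr \<gamma>"
    using g0 by (intro powr_mono2) auto
  moreover have "exp (Re (log_deriv z) / \<gamma>) powr \<gamma> = cmod (deriv f z)"
    using g0 nonzero[OF z] by (simp add: powr_def Re_log_deriv[OF z])
  ultimately show ?thesis by simp
qed

end

section \<open>Distributional derivatives across a thin set\<close>

lemma measurable_Complex_pair [measurable]:
  "(\<lambda>(x, y). Complex x y) \<in> borel_measurable (borel \<Otimes>\<^sub>M borel)"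
proof -
  have "continuous_on UNIV (\<lambda>p::real \<times> real. Complex (fst p) (snd p))"
    unfolding complex_eq by (intro continuous_intros)
  from borel_measurable_continuous_onI[OF this] show ?thesis
    by (simp add: borel_prod case_prod_beta)
qed

text \<open>
  Transports Fubini's theorem from the product of two real lines to the complex plane.
\<close>

lemma lborel_complex_distr:
  "distr (lborel \<Otimes>\<^sub>M lborel) borel (\<lambda>(x, y). Complex x y) = (lborel :: complex measure)"
proof (rule lborel_eqI[symmetric])
  fix l u :: complex
  assume le: "\<And>b. b \<in> Basis \<Longrightarrow> l \<bullet> b \<le> u \<bullet> b"
  have eq: "(\<lambda>(x, y). Complex x y) -` box l u = box (Re l) (Re u) \<times> box (Im l) (Im u)"
    by (auto simp: box_def Basis_complex_def inner_complex_def)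
  have "emeasure (distr (lborel \<Otimes>\<^sub>M lborel) borel (\<lambda>(x, y). Complex x y)) (box l u)
      = emeasure (lborel \<Otimes>\<^sub>M lborel) (box (Re l) (Re u) \<times> box (Im l) (Im u))"
    by (subst emeasure_distr) (auto simp: eq space_pair_measure)
  also have "\<dots> = emeasure lborel (box (Re l) (Re u)) * emeasure lborel (box (Im l) (Im u))"
    by (rule lborel.emeasure_pair_measure_Times) auto
  also have "\<dots> = (\<Prod>b\<in>Basis. (u - l) \<bullet> b)"
    using le[of 1] le[of \<i>]
    by (simp add: Basis_complex_def inner_complex_def ennreal_mult)
  finally show "emeasure (distr (lborel \<Otimes>\<^sub>M lborel) borel (\<lambda>(x, y). Complex x y)) (box l u)
      = (\<Prod>b\<in>Basis. (u - l) \<bullet> b)" .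
qed simp

lemma lborel_complex_Fubini:
  fixes H :: "complex \<Rightarrow> complex"
  assumes "integrable lborel H"
  shows "integral\<^sup>L lborel H = (LINT y|lborel. LINT x|lborel. H (Complex x y))"
    and "integral\<^sup>L lborel H = (LINT x|lborel. LINT y|lborel. H (Complex x y))"
proof -
  have [measurable]: "H \<in> borel_measurable borel" using assms by auto
  have int: "integrable (lborel \<Otimes>\<^sub>M lborel) (\<lambda>(x, y). H (Complex x y))"
    using assms unfolding lborel_complex_distr[symmetric]
    by (subst (asm) integrable_distr_eq) (auto simp: case_prod_beta')
  have eq: "integral\<^sup>L lborel H = integral\<^sup>L (lborel \<Otimes>\<^sub>M lborel) (\<lambda>(x, y). H (Complex x y))"
    unfolding lborel_complex_distr[symmetric]
    by (subst integral_distr) (auto simp: case_prod_beta')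
  show "integral\<^sup>L lborel H = (LINT y|lborel. LINT x|lborel. H (Complex x y))"
    unfolding eq by (rule lborel_pair.integral_snd[OF int, symmetric])
  show "integral\<^sup>L lborel H = (LINT x|lborel. LINT y|lborel. H (Complex x y))"
    unfolding eq by (rule lborel_pair.integral_fst'[OF int, symmetric, unfolded prod.case])
qed

text \<open>
  A continuous function is the integral of its derivative even if the derivative is missing at finitely
  many points.
\<close>

lemma integral_derivative_compact_support:
  fixes u u' :: "real \<Rightarrow> complex"
  assumes "finite S" and cont: "continuous_on UNIV u"
    and der: "\<And>t. t \<notin> S \<Longrightarrow> (u has_vector_derivative u' t) (at t)"
    and supp: "\<And>t. R \<le> \<bar>t\<bar> \<Longrightarrow> u t = 0" "\<And>t. R \<le> \<bar>t\<bar> \<Longrightarrow> u' t = 0"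
  shows "integral\<^sup>L lborel u' = 0"
proof (cases "integrable lborel u'")
  case True
  define b where "b = max R 0"
  have "(u' has_integral (u b - u (- b))) {- b..b}"
    by (rule fundamental_theorem_of_calculus_interior_strong[OF \<open>finite S\<close>])
      (use der cont in \<open>auto simp: b_def intro: continuous_on_subset\<close>)
  then have "(u' has_integral 0) {- b..b}" using supp(1)[of b] supp(1)[of "- b"] by (simp add: b_def)
  then have "(u' has_integral 0) UNIV"
    by (rule has_integral_on_superset) (auto intro!: supp(2) simp: b_def)
  moreover have "(u' has_integral integral\<^sup>L lborel u') UNIV"
    using has_integral_integral_lborel[OF True] .
  ultimately show ?thesis using has_integral_unique by blast
qed (simp add: not_integrable_integral_eq)

text \<open>
  Horizontal and vertical lines meet \<open>E\<close> in finite sets, so the inner integrals in Fubini's theorem vanish.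
\<close>

lemma integral_partial_derivatives_zero:
  fixes G :: "complex \<Rightarrow> complex"
  assumes cont: "continuous_on UNIV G"
    and sect: "\<And>y. finite {x. Complex x y \<in> E}" "\<And>x. finite {y. Complex x y \<in> E}"
    and der: "\<And>z. z \<notin> E \<Longrightarrow> (G has_derivative G' z) (at z)"
    and supp: "\<And>z. R \<le> cmod z \<Longrightarrow> G z = 0" "\<And>z v. R \<le> cmod z \<Longrightarrow> G' z v = 0"
    and int: "integrable lborel (\<lambda>z. G' z 1)" "integrable lborel (\<lambda>z. G' z \<i>)"
  shows "integral\<^sup>L lborel (\<lambda>z. G' z 1) = 0" "integral\<^sup>L lborel (\<lambda>z. G' z \<i>) = 0"
proof -
  have line: "integral\<^sup>L lborel (\<lambda>t. G' (a + of_real t * e) e) = 0"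
    if "finite {t. a + of_real t * e \<in> E}" "\<And>t. \<bar>t\<bar> \<le> cmod (a + of_real t * e)" for a e
  proof (rule integral_derivative_compact_support[OF that(1), of "\<lambda>t. G (a + of_real t * e)" _ R])
    show "continuous_on UNIV (\<lambda>t. G (a + of_real t * e))"
      by (rule continuous_on_compose2[OF cont]) (auto intro!: continuous_intros)
    fix t :: real assume "t \<notin> {t. a + of_real t * e \<in> E}"
    then have d: "(G has_derivative G' (a + of_real t * e)) (at (a + of_real t * e))"
      using der by simp
    have l: "((\<lambda>t. a + of_real t * e) has_derivative (\<lambda>h. of_real h * e)) (at t)"
      by (auto intro!: derivative_eq_intros)
    have "((\<lambda>t. G (a + of_real t * e)) has_derivative (\<lambda>h. G' (a + of_real t * e) (of_real h * e))) (at t)"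
      using has_derivative_compose[OF l d] by simp
    moreover have "G' (a + of_real t * e) (of_real h * e) = h *\<^sub>R G' (a + of_real t * e) e" for h
      using linear_cmul[OF has_derivative_linear[OF d], of h e] by (simp add: scaleR_conv_of_real)
    ultimately show "((\<lambda>t. G (a + of_real t * e)) has_vector_derivative G' (a + of_real t * e) e) (at t)"
      by (simp add: has_vector_derivative_def)
  qed (use that(2) supp order_trans in blast)+
  have "integral\<^sup>L lborel (\<lambda>x. G' (Complex x y) 1) = 0" for y
  proof -
    have "\<i> * of_real y + of_real x * 1 = Complex x y" for x by (simp add: complex_eq_iff)
    then show ?thesis
      using line[of "\<i> * of_real y" 1] sect(1)[of y] abs_Re_le_cmod[of "Complex _ y"]
      by (simp only: complex.sel)
  qed
  then show "integral\<^sup>L lborel (\<lambda>z. G' z 1) = 0"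
    by (simp add: lborel_complex_Fubini(1)[OF int(1)])
  have "integral\<^sup>L lborel (\<lambda>y. G' (Complex x y) \<i>) = 0" for x
  proof -
    have "of_real x + of_real y * \<i> = Complex x y" for y by (simp add: complex_eq_iff)
    then show ?thesis
      using line[of "of_real x" \<i>] sect(2)[of x] abs_Im_le_cmod[of "Complex x _"]
      by (simp only: complex.sel)
  qed
  then show "integral\<^sup>L lborel (\<lambda>z. G' z \<i>) = 0"
    by (simp add: lborel_complex_Fubini(2)[OF int(2)])
qed

lemma locally_integrable_on_imp_lborel:
  assumes [measurable]: "P \<in> borel_measurable borel" and "locally_integrable_on P UNIV"
  shows "integrable lborel (\<lambda>z. indicator (cball 0 R) z *\<^sub>R P z)"
proof -
  have "integrable lebesgue (\<lambda>z. indicator (cball 0 R) z *\<^sub>R P z)"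
    using assms(2) compact_cball unfolding locally_integrable_on_def set_integrable_def by blast
  moreover have "(\<lambda>z. indicator (cball 0 R) z *\<^sub>R P z) \<in> borel_measurable lborel"
    using assms(1) by (intro borel_measurable_scaleR borel_measurable_indicator) auto
  ultimately show ?thesis by (simp add: integrable_completion)
qed

lemma locally_integrable_on_continuous:
  assumes "continuous_on UNIV F"
  shows "locally_integrable_on F UNIV"
  unfolding locally_integrable_on_def set_integrable_def
proof safe
  fix K :: "complex set" assume K: "compact K"
  have "integrable lborel (\<lambda>x. indicator K x *\<^sub>R F x)"
    using K assms by (intro borel_integrable_compact) (auto intro: continuous_on_subset)
  then show "integrable lebesgue (\<lambda>x. indicator K x *\<^sub>R F x)"
    by (rule integrable_completion[THEN iffD2, rotated]) (rule borel_measurable_integrable, fact)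
qed

lemma integrable_mult_compact_support:
  fixes P \<phi> :: "complex \<Rightarrow> complex"
  assumes [measurable]: "P \<in> borel_measurable borel" and "locally_integrable_on P UNIV"
    and cont: "continuous_on UNIV \<phi>" and supp: "\<And>z. R \<le> cmod z \<Longrightarrow> \<phi> z = 0"
  shows "integrable lborel (\<lambda>z. P z * \<phi> z)"
proof -
  have [measurable]: "\<phi> \<in> borel_measurable borel" using cont by (rule borel_measurable_continuous_onI)
  have "compact (\<phi> ` cball 0 R)"
    using cont by (intro compact_continuous_image compact_cball) (auto intro: continuous_on_subset)
  then obtain B where B: "\<And>z. z \<in> cball 0 R \<Longrightarrow> cmod (\<phi> z) \<le> B"
    by (meson bounded_iff compact_imp_bounded imageI)
  show ?thesis
  proof (rule Bochner_Integration.integrable_bound)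
    show "integrable lborel (\<lambda>z. B * norm (indicator (cball 0 R) z *\<^sub>R P z))"
      by (intro integrable_mult_right integrable_norm locally_integrable_on_imp_lborel assms)
    show "AE z in lborel. norm (P z * \<phi> z) \<le> norm (B * norm (indicator (cball 0 R) z *\<^sub>R P z))"
    proof (intro AE_I2)
      fix z
      show "norm (P z * \<phi> z) \<le> norm (B * norm (indicator (cball 0 R) z *\<^sub>R P z))"
      proof (cases "z \<in> cball 0 R")
        case True
        then have "cmod (P z) * cmod (\<phi> z) \<le> cmod (P z) * B" using B by (intro mult_left_mono) auto
        also have "\<dots> \<le> \<bar>B * cmod (P z)\<bar>" by (simp add: mult.commute)
        finally show ?thesis using True by (simp add: norm_mult)
      next
        case False
        then show ?thesis using supp[of z] by simp
      qed
    qed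
  qed measurable
qed

lemma test_functionD:
  assumes "\<phi> \<in> test_functions UNIV"
  obtains R where "continuous_on UNIV \<phi>" "continuous_on UNIV (partial_x \<phi>)" "continuous_on UNIV (partial_y \<phi>)"
    "\<And>z. (\<phi> has_derivative (\<lambda>v. of_real (Re v) * partial_x \<phi> z + of_real (Im v) * partial_y \<phi> z)) (at z)"
    "\<And>z. R \<le> cmod z \<Longrightarrow> \<phi> z = 0 \<and> partial_x \<phi> z = 0 \<and> partial_y \<phi> z = 0"
proof -
  have C: "C_k n \<phi>" for n using assms by (auto simp: test_functions_def)
  have K: "compact (closure {z. \<phi> z \<noteq> 0})" using assms by (auto simp: test_functions_def)
  from C[of 1] have d: "\<And>z. \<phi> differentiable (at z)"
    and c: "continuous_on UNIV (partial_x \<phi>)" "continuous_on UNIV (partial_y \<phi>)" by auto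
  have der: "(\<phi> has_derivative (\<lambda>v. of_real (Re v) * partial_x \<phi> z + of_real (Im v) * partial_y \<phi> z)) (at z)" for z
  proof -
    have fd: "(\<phi> has_derivative frechet_derivative \<phi> (at z)) (at z)"
      using d frechet_derivative_works by blast
    note lin = has_derivative_linear[OF fd]
    have "frechet_derivative \<phi> (at z) v = of_real (Re v) * partial_x \<phi> z + of_real (Im v) * partial_y \<phi> z" for v
    proof -
      have "v = Re v *\<^sub>R 1 + Im v *\<^sub>R \<i>" by (simp add: complex_eq_iff)
      then have "frechet_derivative \<phi> (at z) v
          = Re v *\<^sub>R frechet_derivative \<phi> (at z) 1 + Im v *\<^sub>R frechet_derivative \<phi> (at z) \<i>"
        using linear_add[OF lin] linear_cmul[OF lin] by metis
      then show ?thesis by (simp add: partial_x_def partial_y_def scaleR_conv_of_real)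
    qed
    then have "frechet_derivative \<phi> (at z)
        = (\<lambda>v. of_real (Re v) * partial_x \<phi> z + of_real (Im v) * partial_y \<phi> z)" by (rule ext)
    then show ?thesis using fd by (simp only:)
  qed
  obtain R where R: "\<And>z. z \<in> closure {z. \<phi> z \<noteq> 0} \<Longrightarrow> cmod z < R"
    using compact_imp_bounded[OF K] bounded_pos_less by blast
  have z: "\<phi> z = 0 \<and> partial_x \<phi> z = 0 \<and> partial_y \<phi> z = 0" if "R \<le> cmod z" for z
  proof -
    have z: "z \<in> - closure {z. \<phi> z \<noteq> 0}" using R[of z] that by force
    have "((\<lambda>_. 0) has_derivative (\<lambda>_. 0)) (at z)" by simp
    then have "(\<phi> has_derivative (\<lambda>_. 0)) (at z)"
    proof (rule has_derivative_transform_within_open[OF _ _ z])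
      fix w assume "w \<in> - closure {z. \<phi> z \<noteq> 0}"
      then show "0 = \<phi> w" using closure_subset[of "{z. \<phi> z \<noteq> 0}"] by auto
    qed auto
    then have "frechet_derivative \<phi> (at z) = (\<lambda>_. 0)" by (rule frechet_derivative_at[symmetric])
    moreover have "\<phi> z = 0" using z closure_subset[of "{z. \<phi> z \<noteq> 0}"] by auto
    ultimately show ?thesis by (simp add: partial_x_def partial_y_def)
  qed
  have "continuous_on UNIV \<phi>" using C[of 0] by simp
  from that[OF this c der z] show ?thesis .
qed

text \<open>
  The integrals of both partial derivatives of \<open>F * \<phi>\<close> vanish. This is integration by parts in the two
  coordinate directions, where \<open>P + Q\<close> and \<open>\<i> * (P - Q)\<close> are the partial derivatives of \<open>F\<close>; the Wirtinger
  derivatives are linear combinations of the coordinate derivatives.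
\<close>

lemma distributional_derivatives_off_thin_set:
  fixes F P Q :: "complex \<Rightarrow> complex"
  assumes cont: "continuous_on UNIV F"
    and sect: "\<And>y. finite {x. Complex x y \<in> E}" "\<And>x. finite {y. Complex x y \<in> E}"
    and der: "\<And>z. z \<notin> E \<Longrightarrow> (F has_derivative (\<lambda>v. P z * v + Q z * cnj v)) (at z)"
    and P: "P \<in> borel_measurable borel" "locally_integrable_on P UNIV"
    and Q: "Q \<in> borel_measurable borel" "locally_integrable_on Q UNIV"
  shows "has_distr_deriv_z F P UNIV" "has_distr_deriv_zbar F Q UNIV"
proof -
  have F: "F \<in> borel_measurable borel" "locally_integrable_on F UNIV"
    using cont by (auto intro: borel_measurable_continuous_onI locally_integrable_on_continuous)
  have *: "(LINT z:UNIV|lebesgue. P z * \<phi> z) = - (LINT z:UNIV|lebesgue. F z * wirtinger \<phi> z) \<and>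
      (LINT z:UNIV|lebesgue. Q z * \<phi> z) = - (LINT z:UNIV|lebesgue. F z * wirtinger_bar \<phi> z)"
    if phi: "\<phi> \<in> test_functions UNIV" for \<phi>
  proof -
    obtain R where c: "continuous_on UNIV \<phi>" "continuous_on UNIV (partial_x \<phi>)" "continuous_on UNIV (partial_y \<phi>)"
      and d: "\<And>z. (\<phi> has_derivative (\<lambda>v. of_real (Re v) * partial_x \<phi> z + of_real (Im v) * partial_y \<phi> z)) (at z)"
      and z: "\<And>z. R \<le> cmod z \<Longrightarrow> \<phi> z = 0 \<and> partial_x \<phi> z = 0 \<and> partial_y \<phi> z = 0"
      using test_functionD[OF phi] by metis
    have z': "\<phi> z = 0" "partial_x \<phi> z = 0" "partial_y \<phi> z = 0" if "R \<le> cmod z" for z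
      using z[OF that] by auto
    have iP: "integrable lborel (\<lambda>z. P z * \<phi> z)" and iQ: "integrable lborel (\<lambda>z. Q z * \<phi> z)"
      and ix: "integrable lborel (\<lambda>z. F z * partial_x \<phi> z)"
      and iy: "integrable lborel (\<lambda>z. F z * partial_y \<phi> z)"
      by (rule integrable_mult_compact_support[where R = R]; use P Q F c z' in blast)+
    \<comment> \<open>the derivative of \<open>F * \<phi>\<close>\<close>
    define G' where "G' z v = F z * (of_real (Re v) * partial_x \<phi> z + of_real (Im v) * partial_y \<phi> z)
        + (P z * v + Q z * cnj v) * \<phi> z" for z v
    have G1: "G' z 1 = F z * partial_x \<phi> z + (P z * \<phi> z + Q z * \<phi> z)"
      and Gi: "G' z \<i> = F z * partial_y \<phi> z + (\<i> * (P z * \<phi> z) - \<i> * (Q z * \<phi> z))" for z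
      by (simp_all add: G'_def algebra_simps)
    have i1: "integrable lborel (\<lambda>z. G' z 1)" and i2: "integrable lborel (\<lambda>z. G' z \<i>)"
      unfolding G1 Gi using iP iQ ix iy by auto
    have "integral\<^sup>L lborel (\<lambda>z. G' z 1) = 0 \<and> integral\<^sup>L lborel (\<lambda>z. G' z \<i>) = 0"
    proof -
      have A: "continuous_on UNIV (\<lambda>z. F z * \<phi> z)" using cont c by (intro continuous_intros)
      have B: "((\<lambda>z. F z * \<phi> z) has_derivative G' z) (at z)" if "z \<notin> E" for z
        unfolding G'_def using has_derivative_mult[OF der[OF that] d[of z]] .
      have C: "F z * \<phi> z = 0" "G' z v = 0" if "R \<le> cmod z" for z v
        using z'[OF that] by (auto simp: G'_def)
      show ?thesis using integral_partial_derivatives_zero[OF A sect B C i1 i2] by blast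
    qed
    then have x: "(LINT z|lborel. F z * partial_x \<phi> z) + ((LINT z|lborel. P z * \<phi> z) + (LINT z|lborel. Q z * \<phi> z)) = 0"
      and y: "(LINT z|lborel. F z * partial_y \<phi> z) + (\<i> * (LINT z|lborel. P z * \<phi> z) - \<i> * (LINT z|lborel. Q z * \<phi> z)) = 0"
      unfolding G1 Gi using iP iQ ix iy by auto
    have [measurable]: "F \<in> borel_measurable borel" "P \<in> borel_measurable borel" "Q \<in> borel_measurable borel"
      "\<phi> \<in> borel_measurable borel" "partial_x \<phi> \<in> borel_measurable borel" "partial_y \<phi> \<in> borel_measurable borel"
      using F P Q c by (auto intro: borel_measurable_continuous_onI)
    have leb: "(LINT z:UNIV|lebesgue. h z) = integral\<^sup>L lborel h" if "h \<in> borel_measurable borel"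
      for h :: "complex \<Rightarrow> complex"
      unfolding set_lebesgue_integral_def using that by (simp add: integral_completion)
    have w: "(LINT z|lborel. F z * wirtinger \<phi> z)
        = ((LINT z|lborel. F z * partial_x \<phi> z) - \<i> * (LINT z|lborel. F z * partial_y \<phi> z)) / 2"
    proof -
      have "(\<lambda>z. F z * wirtinger \<phi> z) = (\<lambda>z. (F z * partial_x \<phi> z - \<i> * (F z * partial_y \<phi> z)) / 2)"
        by (auto simp: wirtinger_def algebra_simps)
      then show ?thesis using ix iy by simp
    qed
    have wb: "(LINT z|lborel. F z * wirtinger_bar \<phi> z)
        = ((LINT z|lborel. F z * partial_x \<phi> z) + \<i> * (LINT z|lborel. F z * partial_y \<phi> z)) / 2"
    proof -
      have "(\<lambda>z. F z * wirtinger_bar \<phi> z) = (\<lambda>z. (F z * partial_x \<phi> z + \<i> * (F z * partial_y \<phi> z)) / 2)"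
        by (auto simp: wirtinger_bar_def algebra_simps)
      then show ?thesis using ix iy by simp
    qed
    have [measurable]: "wirtinger \<phi> \<in> borel_measurable borel" "wirtinger_bar \<phi> \<in> borel_measurable borel"
      unfolding wirtinger_def[abs_def] wirtinger_bar_def[abs_def] by measurable
    define ip iq ax ay where "ip = (LINT z|lborel. P z * \<phi> z)" and "iq = (LINT z|lborel. Q z * \<phi> z)"
      and "ax = (LINT z|lborel. F z * partial_x \<phi> z)" and "ay = (LINT z|lborel. F z * partial_y \<phi> z)"
    have ax: "ax = - ip - iq" and ay: "ay = \<i> * iq - \<i> * ip"
      using x y unfolding ip_def iq_def ax_def ay_def by (auto simp: algebra_simps add_eq_0_iff)
    show ?thesis
    proof -
      have "(LINT z:UNIV|lebesgue. P z * \<phi> z) = ip" "(LINT z:UNIV|lebesgue. Q z * \<phi> z) = iq"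
        unfolding ip_def iq_def by (rule leb; measurable)+
      moreover have "(LINT z:UNIV|lebesgue. F z * wirtinger \<phi> z) = (ax - \<i> * ay) / 2"
        unfolding ax_def ay_def w[symmetric] by (rule leb; measurable)
      moreover have "(LINT z:UNIV|lebesgue. F z * wirtinger_bar \<phi> z) = (ax + \<i> * ay) / 2"
        unfolding ax_def ay_def wb[symmetric] by (rule leb; measurable)
      ultimately show ?thesis unfolding ax ay by (simp add: algebra_simps)
    qed
  qed
  show "has_distr_deriv_z F P UNIV" "has_distr_deriv_zbar F Q UNIV"
    unfolding has_distr_deriv_z_def has_distr_deriv_zbar_def using F P Q * by blast+
qed

lemma emeasure_annulus_le:
  fixes e :: real
  assumes "0 \<le> e" "e \<le> 1"
  shows "emeasure lborel {z::complex. \<bar>1 - cmod z\<bar> \<le> e} \<le> ennreal (4 * pi * e)"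
proof -
  have "{z::complex. \<bar>1 - cmod z\<bar> \<le> e} = cball 0 (1 + e) - ball 0 (1 - e)" by auto
  also have "emeasure lborel (cball 0 (1 + e) - ball 0 (1 - e) :: complex set)
      = emeasure lborel (cball 0 (1 + e) :: complex set) - emeasure lborel (ball 0 (1 - e) :: complex set)"
    using assms by (intro emeasure_Diff) (auto simp: emeasure_ball)
  also have "\<dots> = ennreal (pi * (1 + e)\<^sup>2) - ennreal (pi * (1 - e)\<^sup>2)"
    using assms by (simp add: emeasure_cball emeasure_ball unit_ball_vol_2)
  also have "\<dots> = ennreal (pi * (1 + e)\<^sup>2 - pi * (1 - e)\<^sup>2)"
    by (rule ennreal_minus) simp
  also have "pi * (1 + e)\<^sup>2 - pi * (1 - e)\<^sup>2 = 4 * pi * e"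
    by (simp add: algebra_simps power2_eq_square)
  finally show ?thesis by simp
qed

text \<open>
  Cover a neighbourhood of the circle by the annuli \<open>B n\<close> of half-width \<open>1 / 2 ^ n\<close>. The function is at most
  \<open>2 powr (\<gamma> * (n + 1))\<close> on \<open>B n - B (n + 1)\<close>, the area of \<open>B n\<close> is at most \<open>4 * pi / 2 ^ n\<close>, and the resulting geometric
  series has the ratio \<open>2 powr (\<gamma> - 1)\<close>.
\<close>

lemma integrable_power_distance_circle:
  fixes \<gamma> R :: real
  assumes g: "0 \<le> \<gamma>" "\<gamma> < 1"
  shows "integrable lborel (\<lambda>z::complex. indicator (cball 0 R) z *\<^sub>R \<bar>1 - cmod z\<bar> powr (- \<gamma>))"
proof (rule integrableI_bounded)
  define B where "B n = {z::complex. \<bar>1 - cmod z\<bar> \<le> (1/2) ^ n}" for n :: nat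
  define a where "a n = (2 ^ (n + 1)) powr \<gamma>" for n :: nat
  have [measurable]: "B n \<in> sets borel" for n unfolding B_def by measurable
  have bound: "ennreal (norm (indicator (cball 0 R) z *\<^sub>R \<bar>1 - cmod z\<bar> powr (- \<gamma>)))
      \<le> indicator (cball 0 R) z + (\<Sum>n. ennreal (a n) * indicator (B n) z)" for z :: complex
  proof (cases "z \<in> cball 0 R \<and> cmod z \<noteq> 1")
    case True
    define u where "u = \<bar>1 - cmod z\<bar>"
    have u: "0 < u" using True by (auto simp: u_def)
    show ?thesis
    proof (cases "1 \<le> u")
      case True': True
      have "u powr (- \<gamma>) \<le> 1" using True' g by (simp add: powr_minus ge_one_powr_ge_zero inverse_le_1_iff)
      then show ?thesis using True by (simp add: u_def[symmetric] add_increasing2)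
    next
      case False
      have ex: "\<exists>n. (1/2) ^ n < u" using real_arch_pow_inv[OF u, of "1/2"] by auto
      \<comment> \<open>the predecessor of \<open>m\<close> is the index of the dyadic annulus that contains \<open>z\<close>\<close>
      define m where "m = (LEAST n. (1/2) ^ n < u)"
      have m: "(1/2) ^ m < u" unfolding m_def using ex by (rule LeastI_ex)
      have "m \<noteq> 0"
      proof
        assume "m = 0"
        then show False using m False by simp
      qed
      then obtain n where n: "m = Suc n" by (cases m) auto
      have "\<not> (1/2) ^ n < u" unfolding m_def using n not_less_Least[of n "\<lambda>n. (1/2) ^ n < u"] by (simp add: m_def)
      then have zB: "z \<in> B n" by (simp add: B_def u_def)
      have "u powr (- \<gamma>) = (1 / u) powr \<gamma>" using u by (simp add: powr_minus powr_divide inverse_eq_divide)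
      also have "\<dots> \<le> a n" unfolding a_def
        using m n u g by (intro powr_mono2) (auto simp: field_simps)
      finally have "ennreal (u powr (- \<gamma>)) \<le> ennreal (a n) * indicator (B n) z"
        using zB by (simp add: ennreal_leI)
      also have "\<dots> \<le> (\<Sum>n. ennreal (a n) * indicator (B n) z)"
      proof -
        define T where "T n = ennreal (a n) * indicator (B n) z" for n
        have "T n = sum T {n}" by simp
        also have "\<dots> \<le> suminf T" by (intro sum_le_suminf) auto
        finally show ?thesis unfolding T_def .
      qed
      finally show ?thesis using True by (simp add: u_def[symmetric] add_increasing)
    qed
  next
    case False
    then show ?thesis by (auto simp: indicator_def)
  qed
  have "(\<integral>\<^sup>+ z. ennreal (norm (indicator (cball 0 R) z *\<^sub>R \<bar>1 - cmod z\<bar> powr (- \<gamma>))) \<partial>lborel)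
      \<le> (\<integral>\<^sup>+ z. indicator (cball 0 R) z + (\<Sum>n. ennreal (a n) * indicator (B n) z) \<partial>(lborel :: complex measure))"
    by (intro nn_integral_mono bound)
  also have "\<dots> = emeasure lborel (cball 0 R :: complex set) + (\<Sum>n. ennreal (a n) * emeasure lborel (B n))"
    by (subst nn_integral_add)
      (auto simp: nn_integral_suminf nn_integral_cmult_indicator intro!: borel_measurable_indicator)
  also have "\<dots> \<le> emeasure lborel (cball 0 R :: complex set)
      + (\<Sum>n. ennreal (4 * pi * 2 powr \<gamma> * (2 powr (\<gamma> - 1)) ^ n))"
  proof (intro add_left_mono suminf_le)
    fix n
    have "ennreal (a n) * emeasure lborel (B n) \<le> ennreal (a n) * ennreal (4 * pi * (1/2) ^ n)"
      unfolding B_def by (intro mult_left_mono emeasure_annulus_le) (auto simp: power_le_one)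
    also have "\<dots> = ennreal (a n * (4 * pi * (1/2) ^ n))" by (simp add: a_def ennreal_mult)
    also have "a n * (4 * pi * (1/2) ^ n) = 4 * pi * 2 powr \<gamma> * (2 powr (\<gamma> - 1)) ^ n"
    proof -
      have "a n = 2 powr (real (n + 1) * \<gamma>)"
        unfolding a_def by (subst powr_realpow[symmetric]) (simp_all add: powr_powr)
      also have "\<dots> = (2 powr \<gamma>) ^ (n + 1)" by (rule powr_power[symmetric]) simp
      finally have a: "a n = 2 powr \<gamma> * (2 powr \<gamma>) ^ n" by simp
      have h: "(2::real) powr (\<gamma> - 1) = 2 powr \<gamma> / 2" by (simp add: powr_diff)
      show ?thesis unfolding a h by (simp add: power_divide)
    qed
    finally show "ennreal (a n) * emeasure lborel (B n) \<le> ennreal (4 * pi * 2 powr \<gamma> * (2 powr (\<gamma> - 1)) ^ n)" .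
  qed auto
  also have "\<dots> < \<infinity>"
  proof -
    have "(2::real) powr (\<gamma> - 1) < 1" using g by (simp add: powr_less_one)
    then have "summable (\<lambda>n. 4 * pi * 2 powr \<gamma> * (2 powr (\<gamma> - 1)) ^ n)"
      by (intro summable_mult summable_geometric) auto
    then have "(\<Sum>n. ennreal (4 * pi * 2 powr \<gamma> * (2 powr (\<gamma> - 1)) ^ n)) < \<infinity>"
      by (subst suminf_ennreal2) auto
    moreover have "emeasure lborel (cball 0 R :: complex set) < \<infinity>"
      using emeasure_lborel_cball_finite by simp
    ultimately show ?thesis by (simp add: ennreal_add_less_top)
  qed
  finally show "(\<integral>\<^sup>+ z. ennreal (norm (indicator (cball 0 R) z *\<^sub>R \<bar>1 - cmod z\<bar> powr (- \<gamma>))) \<partial>(lborel :: complex measure)) < \<infinity>" .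
next
  have "(\<lambda>z::complex. \<bar>1 - cmod z\<bar> powr (- \<gamma>)) \<in> borel_measurable borel" by measurable
  then show "(\<lambda>z::complex. indicator (cball 0 R) z *\<^sub>R \<bar>1 - cmod z\<bar> powr (- \<gamma>)) \<in> borel_measurable lborel"
    by (intro borel_measurable_scaleR borel_measurable_indicator) auto
qed

lemma locally_integrable_on_power_distance_circle:
  fixes P :: "complex \<Rightarrow> complex"
  assumes g: "0 \<le> \<gamma>" "\<gamma> < 1" and [measurable]: "P \<in> borel_measurable borel"
    and bound: "\<And>R z. 1 \<le> R \<Longrightarrow> cmod z \<le> R \<Longrightarrow> cmod (P z) \<le> C R * \<bar>1 - cmod z\<bar> powr (- \<gamma>)"
  shows "locally_integrable_on P UNIV"
  unfolding locally_integrable_on_def set_integrable_def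
proof (intro allI impI)
  fix K :: "complex set" assume "compact K \<and> K \<subseteq> UNIV"
  then have K: "compact K" by simp
  obtain R0 where "\<And>z. z \<in> K \<Longrightarrow> cmod z \<le> R0"
    using compact_imp_bounded[OF K] unfolding bounded_iff by metis
  then obtain R where R: "1 \<le> R" "K \<subseteq> cball 0 R"
    by (intro that[of "max 1 R0"]) (auto simp: le_max_iff_disj)
  have [measurable]: "K \<in> sets borel" using K by (rule borel_compact)
  have "integrable lborel (\<lambda>x. indicator K x *\<^sub>R P x)"
  proof (rule Bochner_Integration.integrable_bound)
    show "integrable lborel (\<lambda>z::complex. C R * (indicator (cball 0 R) z *\<^sub>R \<bar>1 - cmod z\<bar> powr (- \<gamma>)))"
      by (intro integrable_mult_right integrable_power_distance_circle g)
    show "AE z in lborel. norm (indicator K z *\<^sub>R P z)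
        \<le> norm (C R * (indicator (cball 0 R) z *\<^sub>R \<bar>1 - cmod z\<bar> powr (- \<gamma>)))"
    proof (intro AE_I2)
      fix z
      show "norm (indicator K z *\<^sub>R P z) \<le> norm (C R * (indicator (cball 0 R) z *\<^sub>R \<bar>1 - cmod z\<bar> powr (- \<gamma>)))"
      proof (cases "z \<in> K")
        case True
        then have "z \<in> cball 0 R" using R(2) by blast
        then show ?thesis
          using True bound[OF R(1), of z] abs_ge_self[of "C R * \<bar>1 - cmod z\<bar> powr (- \<gamma>)"] by simp
      qed simp
    qed
  qed measurable
  then show "integrable lebesgue (\<lambda>x. indicator K x *\<^sub>R P x)"
    by (rule integrable_completion[THEN iffD2, rotated]) (rule borel_measurable_integrable, fact)
qed

section \<open>Boundary values and the chain of univalent maps\<close>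

lemma has_vector_derivative_slope:
  fixes f :: "real \<Rightarrow> 'a::real_normed_vector"
  assumes slope: "\<And>y. y \<in> S \<Longrightarrow> f y = f x + (y - x) *\<^sub>R q y"
    and lim: "(q \<longlongrightarrow> d) (at x within S)"
  shows "(f has_vector_derivative d) (at x within S)"
  unfolding has_vector_derivative_def has_derivative_iff_norm
proof
  have "((\<lambda>y. norm (q y - d)) \<longlongrightarrow> 0) (at x within S)"
    using lim by (simp add: tendsto_norm_zero_iff LIM_zero_iff)
  moreover have "\<forall>\<^sub>F y in at x within S. norm (q y - d) = norm (f y - f x - (y - x) *\<^sub>R d) / norm (y - x)"
    unfolding eventually_at_filter
  proof (intro always_eventually allI impI)
    fix y assume "y \<noteq> x" "y \<in> S"
    then have "f y - f x - (y - x) *\<^sub>R d = (y - x) *\<^sub>R (q y - d)"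
      using slope by (simp add: scaleR_right_diff_distrib)
    then show "norm (q y - d) = norm (f y - f x - (y - x) *\<^sub>R d) / norm (y - x)"
      using \<open>y \<noteq> x\<close> by simp
  qed
  ultimately show "((\<lambda>y. norm (f y - f x - (y - x) *\<^sub>R d) / norm (y - x)) \<longlongrightarrow> 0) (at x within S)"
    by (rule Lim_transform_eventually)
qed (rule bounded_linear_scaleR_left)

text \<open>
  The Noshiro-Warschawski argument: the component of \<open>g\<close> in the direction of the segment increases along it.
  Continuity suffices at the end points, which will lie on the unit circle.
\<close>

lemma Re_increment_pos:
  fixes g g' :: "complex \<Rightarrow> complex"
  assumes cont: "continuous_on (closed_segment w z) g" and "w \<noteq> z"
    and der: "\<And>u. u \<in> open_segment w z \<Longrightarrow> (g has_field_derivative g' u) (at u)"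
    and pos: "\<And>u. u \<in> open_segment w z \<Longrightarrow> 0 < Re (g' u)"
  shows "0 < Re ((g z - g w) * cnj (z - w))"
proof -
  define \<sigma> where "\<sigma> t = Re (g (w + of_real t * (z - w)) * cnj (z - w))" for t :: real
  have seg: "w + of_real t * (z - w) \<in> open_segment w z" if "0 < t" "t < 1" for t :: real
    using that \<open>w \<noteq> z\<close> by (auto simp: in_segment scaleR_conv_of_real algebra_simps intro!: exI[of _ t])
  have "\<sigma> 0 < \<sigma> 1"
  proof (rule DERIV_pos_imp_increasing_open[of 0 1 \<sigma>])
    fix t :: real assume t: "0 < t" "t < 1"
    have l: "((\<lambda>t. w + of_real t * (z - w)) has_vector_derivative (z - w)) (at t)"
      by (auto intro!: derivative_eq_intros)
    have "((\<lambda>t. g (w + of_real t * (z - w))) has_vector_derivative (z - w) * g' (w + of_real t * (z - w))) (at t)"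
      using field_vector_diff_chain_at[OF l der[OF seg[OF t]]] by (simp add: o_def)
    then have "((\<lambda>t. g (w + of_real t * (z - w)) * cnj (z - w)) has_vector_derivative
        (z - w) * g' (w + of_real t * (z - w)) * cnj (z - w)) (at t)"
      by (rule has_vector_derivative_mult_left)
    then have "(\<sigma> has_real_derivative Re ((z - w) * g' (w + of_real t * (z - w)) * cnj (z - w))) (at t)"
      unfolding \<sigma>_def by (simp only: has_vector_derivative_complex_iff)
    moreover have "Re ((z - w) * g' (w + of_real t * (z - w)) * cnj (z - w))
        = (cmod (z - w))\<^sup>2 * Re (g' (w + of_real t * (z - w)))"
      by (simp only: cmod_power2) (simp add: algebra_simps power2_eq_square)
    moreover have "0 < (cmod (z - w))\<^sup>2 * Re (g' (w + of_real t * (z - w)))"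
      using pos[OF seg[OF t]] \<open>w \<noteq> z\<close> by simp
    ultimately show "\<exists>y. (\<sigma> has_real_derivative y) (at t) \<and> 0 < y" by metis
  next
    have "w + of_real t * (z - w) \<in> closed_segment w z" if "t \<in> {0..1}" for t :: real
      using that by (auto simp: in_segment scaleR_conv_of_real algebra_simps intro!: exI[of _ t])
    then show "continuous_on {0..1} \<sigma>"
      unfolding \<sigma>_def by (intro continuous_intros continuous_on_compose2[OF cont]) auto
  qed auto
  then show ?thesis by (simp add: \<sigma>_def algebra_simps)
qed

context sector_derivative
begin

lemma f_deriv: "(f has_field_derivative deriv f z) (at z)" if "z \<in> ball 0 1"
  using holomorphic_derivI[OF hol _ that] by simp

text \<open>
  Integration of the growth bound \<open>\<bar>f'\<bar> \<le> (2 / (1 - t)) powr \<gamma>\<close> along a radius.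
\<close>

lemma radial_increment_le:
  assumes z: "z \<in> cball 0 1" and ab: "0 \<le> a" "a < b" "b < 1"
  shows "cmod (f (of_real b * z) - f (of_real a * z)) \<le> 2 powr \<gamma> / (1 - \<gamma>) * (1 - a) powr (1 - \<gamma>)"
proof -
  define \<phi> where "\<phi> t = - (2 powr \<gamma> / (1 - \<gamma>)) * (1 - t) powr (1 - \<gamma>)" for t :: real
  have tz: "of_real t * z \<in> ball 0 1" if "0 \<le> t" "t < 1" for t :: real
    using that z mult_left_le[of "cmod z" t] by (simp add: norm_mult)
  have vd: "((\<lambda>t. f (of_real t * z)) has_vector_derivative z * deriv f (of_real t * z)) (at t)"
    if "0 \<le> t" "t < 1" for t :: real
  proof -
    have l: "((\<lambda>t. of_real t * z) has_vector_derivative z) (at t)"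
      by (auto intro!: derivative_eq_intros)
    show ?thesis using field_vector_diff_chain_at[OF l f_deriv[OF tz[OF that]]] by (simp add: o_def)
  qed
  have "cmod (f (of_real b * z) - f (of_real a * z)) \<le> \<phi> b - \<phi> a"
  proof (rule differentiable_bound_general[OF \<open>a < b\<close>])
    show "continuous_on {a..b} (\<lambda>t. f (of_real t * z))"
      by (intro continuous_at_imp_continuous_on ballI has_vector_derivative_continuous[OF vd])
        (use ab in auto)
    show "continuous_on {a..b} \<phi>" unfolding \<phi>_def using ab gamma
      by (intro continuous_intros) auto
    fix t assume t: "a < t" "t < b"
    then show "((\<lambda>t. f (of_real t * z)) has_vector_derivative z * deriv f (of_real t * z)) (at t)"
      using vd ab by simp
    have "(\<phi> has_real_derivative 2 powr \<gamma> * (1 - t) powr (- \<gamma>)) (at t)"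
    proof -
      have "((\<lambda>t. (1 - t) powr (1 - \<gamma>)) has_real_derivative (1 - \<gamma>) * (1 - t) powr (1 - \<gamma> - of_nat 1) * (- 1)) (at t)"
        using t ab by (intro DERIV_fun_powr) (auto intro!: derivative_eq_intros)
      from DERIV_cmult[OF this, of "- (2 powr \<gamma> / (1 - \<gamma>))"] show ?thesis
        unfolding \<phi>_def using gamma by simp
    qed
    then show "(\<phi> has_vector_derivative 2 powr \<gamma> * (1 - t) powr (- \<gamma>)) (at t)"
      by (simp add: has_real_derivative_iff_has_vector_derivative)
    have t1: "of_real t * z \<in> ball 0 1" using tz t ab by simp
    have "cmod z * cmod (deriv f (of_real t * z)) \<le> 1 * (2 / (1 - cmod (of_real t * z))) powr \<gamma>"
      using z deriv_growth[OF t1] by (intro mult_mono) auto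
    also have "\<dots> \<le> (2 / (1 - t)) powr \<gamma>"
    proof -
      have "cmod (of_real t * z) \<le> t" using z t ab mult_left_le[of "cmod z" t] by (simp add: norm_mult)
      then show ?thesis using t ab gamma by (auto intro!: powr_mono2 divide_left_mono mult_pos_pos)
    qed
    also have "\<dots> = 2 powr \<gamma> * (1 - t) powr (- \<gamma>)"
      using t ab by (simp add: powr_divide powr_minus_divide)
    finally show "cmod (z * deriv f (of_real t * z)) \<le> 2 powr \<gamma> * (1 - t) powr (- \<gamma>)"
      by (simp add: norm_mult)
  qed
  also have "\<dots> \<le> 2 powr \<gamma> / (1 - \<gamma>) * (1 - a) powr (1 - \<gamma>)"
    using gamma by (simp add: \<phi>_def)
  finally show ?thesis .
qed

text \<open>
  By \<open>radial_increment_le\<close> the dilations \<open>f (r * z)\<close> are uniformly Cauchy on the closed disc as \<open>r\<close> tends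
  to 1.
\<close>

lemma continuous_extension_to_cball:
  "\<exists>g. continuous_on (cball 0 1) g \<and> (\<forall>z\<in>ball 0 1. g z = f z)"
proof -
  define r where "r n = 1 - inverse (real (Suc n))" for n
  have r01: "0 \<le> r n" "r n < 1" for n by (auto simp: r_def field_simps)
  have r_mono: "r m < r n" if "m < n" for m n using that by (simp add: r_def field_simps)
  have r_lim: "r \<longlonglongrightarrow> 1"
    unfolding r_def using tendsto_diff[OF tendsto_const LIMSEQ_inverse_real_of_nat] by simp
  define F where "F n z = f (of_real (r n) * z)" for n z
  define K where "K = 2 powr \<gamma> / (1 - \<gamma>)"
  have rz: "of_real (r n) * z \<in> ball 0 1" if "z \<in> cball 0 1" for n and z :: complex
    using that mult_left_le[of "cmod z" "r n"] r01[of n] by (simp add: norm_mult)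
  have "uniformly_Cauchy_on (cball 0 1) F"
  proof (rule uniformly_Cauchy_onI')
    fix e :: real assume "0 < e"
    have "(\<lambda>n. (1 - r n) powr (1 - \<gamma>)) \<longlonglongrightarrow> 0"
    proof (rule tendsto_zero_powrI)
      show "(\<lambda>n. 1 - r n) \<longlonglongrightarrow> 0" using tendsto_diff[OF tendsto_const r_lim, of 1] by simp
    qed (use gamma r01 in \<open>auto intro!: always_eventually less_imp_le\<close>)
    then have "(\<lambda>n. K * (1 - r n) powr (1 - \<gamma>)) \<longlonglongrightarrow> 0" by (rule tendsto_mult_right_zero)
    then have "\<forall>\<^sub>F n in sequentially. K * (1 - r n) powr (1 - \<gamma>) < e"
      using \<open>0 < e\<close> by (rule order_tendstoD)
    then obtain M where M: "\<And>n. M \<le> n \<Longrightarrow> K * (1 - r n) powr (1 - \<gamma>) < e"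
      unfolding eventually_sequentially by blast
    have "dist (F m z) (F n z) < e" if "z \<in> cball 0 1" "M \<le> m" "m < n" for z m n
      using radial_increment_le[OF that(1) r01(1) r_mono[OF that(3)] r01(2)] M[OF that(2)]
      unfolding F_def K_def by (simp add: dist_norm norm_minus_commute)
    then show "\<exists>M. \<forall>z\<in>cball 0 1. \<forall>m\<ge>M. \<forall>n>m. dist (F m z) (F n z) < e" by blast
  qed
  then obtain g where g: "uniform_limit (cball 0 1) F g sequentially"
    using Cauchy_uniformly_convergent uniformly_convergent_on_def by blast
  have fc: "continuous_on (ball 0 1) f" using hol by (rule holomorphic_on_imp_continuous_on)
  have "continuous_on (cball 0 1) g"
  proof (rule uniform_limit_theorem[OF _ g])
    have "continuous_on (cball 0 1) (F n)" for n
      unfolding F_def using rz by (intro continuous_on_compose2[OF fc] continuous_intros) auto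
    then show "\<forall>\<^sub>F n in sequentially. continuous_on (cball 0 1) (F n)" by simp
  qed simp
  moreover have "g z = f z" if z: "z \<in> ball 0 1" for z
  proof -
    have "(\<lambda>n. F n z) \<longlonglongrightarrow> g z" using tendsto_uniform_limitI[OF g, of z] z by simp
    moreover have "(\<lambda>n. F n z) \<longlonglongrightarrow> f z"
    proof -
      have "(\<lambda>n. of_real (r n) * z) \<longlonglongrightarrow> of_real 1 * z" by (intro tendsto_intros r_lim)
      moreover have "isCont f z" using f_deriv[OF z] DERIV_isCont by blast
      ultimately show ?thesis unfolding F_def using isCont_tendsto_compose by fastforce
    qed
    ultimately show ?thesis by (rule LIMSEQ_unique)
  qed
  ultimately show ?thesis by blast
qed

definition closed_ext :: "complex \<Rightarrow> complex" where
  "closed_ext = (SOME g. continuous_on (cball 0 1) g \<and> (\<forall>z\<in>ball 0 1. g z = f z))"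

lemma closed_ext: "continuous_on (cball 0 1) closed_ext" "\<And>z. z \<in> ball 0 1 \<Longrightarrow> closed_ext z = f z"
  using someI_ex[OF continuous_extension_to_cball] unfolding closed_ext_def by auto

lemma Re_closed_ext_increment_pos:
  assumes "z \<in> cball 0 1" "w \<in> cball 0 1" "z \<noteq> w"
  shows "0 < Re ((closed_ext z - closed_ext w) * cnj (z - w))"
proof (rule Re_increment_pos)
  show "continuous_on (closed_segment w z) closed_ext"
    using assms by (intro continuous_on_subset[OF closed_ext(1)] closed_segment_subset) auto
  fix u assume "u \<in> open_segment w z"
  then have u: "u \<in> ball 0 1" using dist_decreases_open_segment[of u w z 0] assms by auto
  show "(closed_ext has_field_derivative deriv f u) (at u)"
    by (rule has_field_derivative_transform_within_open[OF f_deriv[OF u] open_ball u])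
      (simp add: closed_ext(2))
  show "0 < Re (deriv f u)" by (rule Re_deriv_pos[OF u])
qed (use assms in auto)

lemma inj_closed_ext: "inj_on closed_ext (cball 0 1)"
  using Re_closed_ext_increment_pos by (fastforce intro!: inj_onI)

text \<open>
  On a smaller closed disc \<open>Re f'\<close> has a positive minimum, and \<open>Re_increment_pos\<close> applies to
  \<open>f z - \<mu> * z\<close>.
\<close>

lemma Re_increment_ge:
  assumes "r < 1"
  obtains \<mu> where "0 < \<mu>"
    "\<And>z w. cmod z \<le> r \<Longrightarrow> cmod w \<le> r \<Longrightarrow> \<mu> * (cmod (z - w))\<^sup>2 \<le> Re ((f z - f w) * cnj (z - w))"
    "\<And>z. cmod z \<le> r \<Longrightarrow> \<mu> \<le> Re (deriv f z)"
proof (cases "r < 0")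
  case True
  then show ?thesis using that[of 1] by (metis less_le_not_le norm_ge_zero order_trans zero_less_one)
next
  case False
  have sub: "cball 0 r \<subseteq> ball (0::complex) 1" using assms by auto
  have "continuous_on (cball 0 r) (\<lambda>z. Re (deriv f z))"
    using deriv_hol sub
    by (intro continuous_intros holomorphic_on_imp_continuous_on) (rule holomorphic_on_subset)
  then obtain z0 where z0: "z0 \<in> cball 0 r" "\<And>z. z \<in> cball 0 r \<Longrightarrow> Re (deriv f z0) \<le> Re (deriv f z)"
    using continuous_attains_inf[of "cball 0 r" "\<lambda>z. Re (deriv f z)"] False by auto
  define \<mu> where "\<mu> = Re (deriv f z0) / 2"
  have mu: "0 < \<mu>" using Re_deriv_pos[of z0] z0(1) sub by (auto simp: \<mu>_def)
  have mu_less: "\<mu> < Re (deriv f z)" if "cmod z \<le> r" for z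
    using z0(2)[of z] that mu by (simp add: \<mu>_def)
  have "\<mu> * (cmod (z - w))\<^sup>2 \<le> Re ((f z - f w) * cnj (z - w))" if zw: "cmod z \<le> r" "cmod w \<le> r" for z w
  proof (cases "z = w")
    case False
    have seg: "u \<in> cball 0 r" if "u \<in> closed_segment w z" for u
      using that zw closed_segment_subset[of w "cball 0 r" z] by auto
    \<comment> \<open>the derivative \<open>f' - \<mu>\<close> still has a positive real part, as \<open>\<mu>\<close> is half the minimum\<close>
    have "0 < Re ((f z - \<mu> * z - (f w - \<mu> * w)) * cnj (z - w))"
    proof (rule Re_increment_pos[where g' = "\<lambda>u. deriv f u - \<mu>"])
      show "continuous_on (closed_segment w z) (\<lambda>z. f z - \<mu> * z)"
        using hol seg sub by (intro continuous_intros holomorphic_on_imp_continuous_on holomorphic_on_subset[OF hol]) auto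
      fix u assume "u \<in> open_segment w z"
      then have u: "cmod u \<le> r" using seg by (simp add: open_segment_def)
      then have "u \<in> ball 0 1" using assms by simp
      then show "((\<lambda>z. f z - \<mu> * z) has_field_derivative deriv f u - \<mu>) (at u)"
        by (auto intro!: derivative_eq_intros f_deriv)
      show "0 < Re (deriv f u - \<mu>)" using mu_less[OF u] by simp
    qed (use False in auto)
    moreover have "(f z - \<mu> * z - (f w - \<mu> * w)) * cnj (z - w)
        = (f z - f w) * cnj (z - w) - of_real (\<mu> * (cmod (z - w))\<^sup>2)"
      unfolding of_real_mult complex_norm_square by (simp add: algebra_simps)
    ultimately have "0 < Re ((f z - f w) * cnj (z - w)) - \<mu> * (cmod (z - w))\<^sup>2"
      by (simp only: minus_complex.sel Re_complex_of_real)
    then show ?thesis by linarith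
  qed simp
  then show ?thesis using that[OF mu] mu_less by (meson less_imp_le)
qed

lemma Re_slope_pos:
  assumes "z \<in> ball 0 1" "w \<in> ball 0 1" "z \<noteq> w"
  shows "0 < Re ((f z - f w) / (z - w))"
proof -
  have "0 < Re ((f z - f w) * cnj (z - w))"
    using Re_closed_ext_increment_pos[of z w] assms closed_ext(2) by auto
  moreover have "(f z - f w) / (z - w) = (f z - f w) * cnj (z - w) / of_real ((cmod (z - w))\<^sup>2)"
    using assms(3) by (subst complex_norm_square) simp
  ultimately show ?thesis using assms(3) by simp
qed

text \<open>
  The difference quotient of \<open>f\<close> with its removable singularity filled in, so that it is continuous in \<open>z\<close>.
\<close>

definition slope :: "complex \<Rightarrow> complex \<Rightarrow> complex" where
  "slope w z = (if z = w then deriv f w else (f z - f w) / (z - w))"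

lemma slope_continuous: "continuous_on (ball 0 1) (slope w)"
  unfolding slope_def[abs_def]
  by (intro holomorphic_on_imp_continuous_on pole_lemma_open hol open_ball)

lemma Re_slope: "0 < Re (slope w z)" if "w \<in> ball 0 1" "z \<in> ball 0 1"
  using that Re_slope_pos Re_deriv_pos by (simp add: slope_def)

lemma slope_eq: "f z - f w = slope w z * (z - w)"
  by (simp add: slope_def)

text \<open>
  The maps \<open>f z + t * z\<close> satisfy the same positivity condition as \<open>f\<close>.
\<close>

lemma chain_inj:
  assumes "z \<in> ball 0 1" "w \<in> ball 0 1" "0 \<le> t" "f z + of_real t * z = f w + of_real t * w"
  shows "z = w"
proof -
  have "(slope w z + of_real t) * (z - w) = (f z + of_real t * z) - (f w + of_real t * w)"
    using slope_eq[of z w] by algebra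
  moreover have "slope w z + of_real t \<noteq> 0"
    using Re_slope[OF assms(2,1)] assms(3) by (auto simp: complex_eq_iff)
  ultimately show ?thesis using assms(4) by simp
qed

text \<open>
  The images of the disc under \<open>f z + t * z\<close> increase with \<open>t\<close>. With \<open>m\<close> the slope of \<open>f\<close> between \<open>w\<close> and
  \<open>z\<close>, the equation is equivalent to \<open>z = w * (m + s) / (m + t)\<close>. As \<open>Re m > 0\<close> and \<open>s \<le> t\<close>, the right side maps
  the disc \<open>\<bar>z\<bar> \<le> \<bar>w\<bar>\<close> into itself, and Brouwer's theorem yields a fixed point.
\<close>

lemma chain_subordination:
  assumes w: "w \<in> ball 0 1" and st: "0 \<le> s" "s \<le> t"
  shows "\<exists>z. cmod z \<le> cmod w \<and> f z + of_real t * z = f w + of_real s * w"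
proof (cases "w = 0")
  case True
  then show ?thesis by (intro exI[of _ 0]) (simp add: f_0)
next
  case False
  have w1: "cmod w < 1" using w by simp
  have sub: "cball 0 (cmod w) \<subseteq> ball 0 1" using w1 by auto
  define \<Psi> where "\<Psi> z = w * ((slope w z + of_real s) / (slope w z + of_real t))" for z :: complex
  have nz: "slope w z + of_real t \<noteq> 0" if "z \<in> ball 0 1" for z :: complex
    using Re_slope[OF w that] st by (auto simp: complex_eq_iff)
  have "continuous_on (cball 0 (cmod w)) \<Psi>"
    unfolding \<Psi>_def using nz sub
    by (intro continuous_intros continuous_on_subset[OF slope_continuous sub]) auto
  moreover have "\<Psi> \<in> cball 0 (cmod w) \<rightarrow> cball 0 (cmod w)"
  proof
    fix z :: complex assume "z \<in> cball 0 (cmod w)"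
    then have z: "z \<in> ball 0 1" using sub by blast
    have "cmod (slope w z + of_real s) \<le> cmod (slope w z + of_real t)"
      unfolding cmod_def using Re_slope[OF w z] st
      by (intro real_sqrt_le_mono add_mono) (auto intro!: power_mono)
    then have "cmod ((slope w z + of_real s) / (slope w z + of_real t)) \<le> 1"
      by (simp add: norm_divide divide_le_eq_1)
    then have "cmod (\<Psi> z) \<le> cmod w" unfolding \<Psi>_def norm_mult by (rule mult_left_le) simp
    then show "\<Psi> z \<in> cball 0 (cmod w)" by simp
  qed
  ultimately obtain z where z: "z \<in> cball 0 (cmod w)" "\<Psi> z = z"
    using brouwer_ball[of "cmod w" 0 \<Psi>] False by auto
  have zb: "z \<in> ball 0 1" using z sub by blast
  have "w * (slope w z + of_real s) = z * (slope w z + of_real t)"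
    using z(2) nz[OF zb] unfolding \<Psi>_def by (simp add: field_simps)
  then have "f z + of_real t * z = f w + of_real s * w"
    using slope_eq[of z w] by algebra
  then show ?thesis using z(1) by (intro exI[of _ z]) simp
qed

text \<open>
  Let \<open>Z \<tau>\<close> be the point at which the map of time \<open>\<tau>\<close> takes the given value. Subtraction of the equations for
  two times gives \<open>(m + \<tau>) * (Z \<tau> - Z \<sigma>) = - (\<tau> - \<sigma>) * Z \<sigma>\<close> with \<open>m\<close> the slope between the two points. Since \<open>Re m\<close> is bounded
  below, \<open>Z\<close> is Lipschitz continuous, so \<open>m\<close> tends to the derivative of \<open>f\<close> and the difference quotients of \<open>Z\<close> converge.
\<close>

lemma chain_trajectory:
  assumes w: "w \<in> ball 0 1" "w \<noteq> 0" and st: "0 \<le> s" "s \<le> t"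
  obtains Z where "Z s = w"
    "\<And>\<tau>. \<tau> \<in> {s..t} \<Longrightarrow> Z \<tau> \<in> ball 0 1 - {0} \<and> f (Z \<tau>) + of_real \<tau> * Z \<tau> = f w + of_real s * w"
    "\<And>\<tau>. \<tau> \<in> {s..t} \<Longrightarrow> (Z has_vector_derivative - Z \<tau> / (deriv f (Z \<tau>) + of_real \<tau>)) (at \<tau> within {s..t})"
proof -
  define a where "a = f w + of_real s * w"
  have "\<exists>z. cmod z \<le> cmod w \<and> f z + of_real \<tau> * z = a" if "\<tau> \<in> {s..t}" for \<tau>
    unfolding a_def using that w st by (intro chain_subordination) auto
  then obtain Z where Z: "\<And>\<tau>. \<tau> \<in> {s..t} \<Longrightarrow> cmod (Z \<tau>) \<le> cmod w \<and> f (Z \<tau>) + of_real \<tau> * Z \<tau> = a"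
    by metis
  have w1: "cmod w < 1" using w by simp
  have Zb: "Z \<tau> \<in> ball 0 1" if "\<tau> \<in> {s..t}" for \<tau> using Z[OF that] w1 by simp
  have a0: "a \<noteq> 0"
  proof
    assume "a = 0"
    then have "f w + of_real s * w = f 0 + of_real s * 0" by (simp add: a_def f_0)
    then show False using chain_inj[of w 0 s] w st by simp
  qed
  have Z0: "Z \<tau> \<noteq> 0" if "\<tau> \<in> {s..t}" for \<tau>
    using Z[OF that] a0 by (auto simp: f_0)
  obtain \<mu> where mu: "0 < \<mu>" "\<And>z. cmod z \<le> cmod w \<Longrightarrow> \<mu> \<le> Re (deriv f z)"
     "\<And>z u. cmod z \<le> cmod w \<Longrightarrow> cmod u \<le> cmod w \<Longrightarrow> \<mu> * (cmod (z - u))\<^sup>2 \<le> Re ((f z - f u) * cnj (z - u))"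
    using Re_increment_ge[OF w1] by metis
  have rel: "(slope (Z \<sigma>) (Z \<tau>) + of_real \<tau>) * (Z \<tau> - Z \<sigma>) = - of_real (\<tau> - \<sigma>) * Z \<sigma>"
    if "\<tau> \<in> {s..t}" "\<sigma> \<in> {s..t}" for \<tau> \<sigma>
  proof -
    have "(slope (Z \<sigma>) (Z \<tau>) + of_real \<tau>) * (Z \<tau> - Z \<sigma>)
        = (f (Z \<tau>) + of_real \<tau> * Z \<tau>) - (f (Z \<sigma>) + of_real \<sigma> * Z \<sigma>) - of_real (\<tau> - \<sigma>) * Z \<sigma>"
      using slope_eq[of "Z \<tau>" "Z \<sigma>"] unfolding of_real_diff by algebra
    moreover have "f (Z \<tau>) + of_real \<tau> * Z \<tau> = a" "f (Z \<sigma>) + of_real \<sigma> * Z \<sigma> = a"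
      using Z that by auto
    ultimately show ?thesis by (simp only: diff_self diff_0 mult_minus_left)
  qed
  have slope_mu: "\<mu> \<le> Re (slope (Z \<sigma>) (Z \<tau>))" if "\<tau> \<in> {s..t}" "\<sigma> \<in> {s..t}" for \<tau> \<sigma>
  proof (cases "Z \<tau> = Z \<sigma>")
    case True
    then show ?thesis using mu(2) Z that by (simp add: slope_def)
  next
    case False
    have "slope (Z \<sigma>) (Z \<tau>) = (f (Z \<tau>) - f (Z \<sigma>)) * cnj (Z \<tau> - Z \<sigma>) / of_real ((cmod (Z \<tau> - Z \<sigma>))\<^sup>2)"
      using False by (subst complex_norm_square) (simp add: slope_def)
    then have "Re (slope (Z \<sigma>) (Z \<tau>)) = Re ((f (Z \<tau>) - f (Z \<sigma>)) * cnj (Z \<tau> - Z \<sigma>)) / (cmod (Z \<tau> - Z \<sigma>))\<^sup>2"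
      by simp
    moreover have "\<mu> * (cmod (Z \<tau> - Z \<sigma>))\<^sup>2 \<le> Re ((f (Z \<tau>) - f (Z \<sigma>)) * cnj (Z \<tau> - Z \<sigma>))"
      using mu(3) Z that by blast
    ultimately show ?thesis using False by (simp add: pos_le_divide_eq)
  qed
  have lip: "cmod (Z \<tau> - Z \<sigma>) \<le> \<bar>\<tau> - \<sigma>\<bar> / \<mu>" if ts: "\<tau> \<in> {s..t}" "\<sigma> \<in> {s..t}" for \<tau> \<sigma>
  proof -
    have "\<mu> \<le> Re (slope (Z \<sigma>) (Z \<tau>) + of_real \<tau>)" using slope_mu[OF ts] ts st by simp
    also have "\<dots> \<le> cmod (slope (Z \<sigma>) (Z \<tau>) + of_real \<tau>)" by (rule complex_Re_le_cmod)
    finally have "\<mu> * cmod (Z \<tau> - Z \<sigma>) \<le> cmod (slope (Z \<sigma>) (Z \<tau>) + of_real \<tau>) * cmod (Z \<tau> - Z \<sigma>)"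
      by (intro mult_right_mono) auto
    also have "\<dots> = \<bar>\<tau> - \<sigma>\<bar> * cmod (Z \<sigma>)"
      using arg_cong[OF rel[OF ts], of cmod] by (simp only: norm_mult norm_minus_cancel norm_of_real)
    also have "\<dots> \<le> \<bar>\<tau> - \<sigma>\<bar> * 1" using Zb[OF ts(2)] by (intro mult_left_mono) auto
    finally show ?thesis using mu(1) by (simp add: pos_le_divide_eq mult.commute)
  qed
  have der: "(Z has_vector_derivative - Z \<tau> / (deriv f (Z \<tau>) + of_real \<tau>)) (at \<tau> within {s..t})"
    if tau: "\<tau> \<in> {s..t}" for \<tau>
  proof (rule has_vector_derivative_slope)
    fix y assume y: "y \<in> {s..t}"
    have "slope (Z \<tau>) (Z y) + of_real y \<noteq> 0"
      using Re_slope[OF Zb[OF tau] Zb[OF y]] y st by (auto simp: complex_eq_iff)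
    then show "Z y = Z \<tau> + (y - \<tau>) *\<^sub>R (- Z \<tau> / (slope (Z \<tau>) (Z y) + of_real y))"
      using rel[OF y tau] by (simp add: scaleR_conv_of_real field_simps)
  next
    have Zlim: "(Z \<longlongrightarrow> Z \<tau>) (at \<tau> within {s..t})"
    proof (rule LIM_zero_cancel, rule Lim_null_comparison)
      show "\<forall>\<^sub>F y in at \<tau> within {s..t}. norm (Z y - Z \<tau>) \<le> \<bar>y - \<tau>\<bar> / \<mu>"
        unfolding eventually_at_filter using lip tau by (intro always_eventually) blast
      show "((\<lambda>y. \<bar>y - \<tau>\<bar> / \<mu>) \<longlongrightarrow> 0) (at \<tau> within {s..t})"
        using mu(1) by (auto intro!: tendsto_eq_intros)
    qed
    have "isCont (slope (Z \<tau>)) (Z \<tau>)"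
      using slope_continuous Zb[OF tau] by (simp add: continuous_on_eq_continuous_at)
    then have "((\<lambda>y. slope (Z \<tau>) (Z y)) \<longlongrightarrow> slope (Z \<tau>) (Z \<tau>)) (at \<tau> within {s..t})"
      using Zlim by (rule isCont_tendsto_compose)
    moreover have "deriv f (Z \<tau>) + of_real \<tau> \<noteq> 0"
      using Re_deriv_pos[OF Zb[OF tau]] tau st by (auto simp: complex_eq_iff)
    ultimately show "((\<lambda>y. - Z \<tau> / (slope (Z \<tau>) (Z y) + of_real y)) \<longlongrightarrow>
        - Z \<tau> / (deriv f (Z \<tau>) + of_real \<tau>)) (at \<tau> within {s..t})"
      by (auto intro!: tendsto_intros simp: slope_def[of "Z \<tau>" "Z \<tau>"])
  qed
  have "s \<in> {s..t}" using st by simp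
  then have "Z s = w" using chain_inj[OF Zb w(1) st(1)] Z by (simp add: a_def)
  then show ?thesis using that[of Z] Zb Z0 Z der unfolding a_def by blast
qed

end

section \<open>The quasiconformal extension\<close>

lemma Re_of_real_mult: "Re (of_real x * z) = x * Re z"
  by simp

lemma inverse_cnj_bij: "inj_on (\<lambda>w. 1 / cnj w) (- cball 0 1)"
    "\<And>w. w \<in> - cball 0 1 \<Longrightarrow> 1 / cnj w \<in> ball 0 1 - {0}"
proof -
  show "inj_on (\<lambda>w. 1 / cnj w) (- cball 0 1)" by (auto intro!: inj_onI)
  show "1 / cnj w \<in> ball 0 1 - {0}" if "w \<in> - cball 0 1" for w
    using that by (auto simp: norm_divide not_le divide_less_eq_1)
qed

lemma finite_sections_circle:
  "finite {x. Complex x y \<in> sphere 0 1}" "finite {y. Complex x y \<in> sphere 0 1}"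
proof -
  have "finite {t::real. t\<^sup>2 = d}" for d
  proof (rule finite_subset)
    show "{t. t\<^sup>2 = d} \<subseteq> {sqrt d, - sqrt d}" using real_sqrt_abs by (auto simp: abs_if split: if_splits)
  qed simp
  moreover have "x\<^sup>2 = 1 - y\<^sup>2 \<and> y\<^sup>2 = 1 - x\<^sup>2" if "Complex x y \<in> sphere 0 1" for x y
    using that by (auto simp: cmod_def real_sqrt_eq_1_iff)
  ultimately show "finite {x. Complex x y \<in> sphere 0 1}" "finite {y. Complex x y \<in> sphere 0 1}"
    by (metis (mono_tags, lifting) finite_subset mem_Collect_eq subsetI)+
qed

context sector_derivative
begin

definition cos\<alpha> where "cos\<alpha> = cos (\<gamma> * pi / 2)"
definition sin\<alpha> where "sin\<alpha> = sin (\<gamma> * pi / 2)"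

lemma cs: "0 < cos\<alpha>" "0 \<le> sin\<alpha>" "sin\<alpha> < 1" "cos\<alpha> \<le> 1"
proof -
  show "0 < cos\<alpha>" unfolding cos\<alpha>_def by (rule cos_gt_zero_pi) (use alpha in linarith)+
  show "0 \<le> sin\<alpha>" unfolding sin\<alpha>_def by (rule sin_ge_zero) (use alpha in linarith)+
  have "sin\<alpha> < sin (pi / 2)" unfolding sin\<alpha>_def by (rule sin_monotone_2pi) (use alpha in linarith)+
  then show "sin\<alpha> < 1" by simp
qed (simp add: cos\<alpha>_def)

definition weight :: "complex \<Rightarrow> real" where
  "weight z = (1 / (cmod z)\<^sup>2 - 1) / cos\<alpha>"

text \<open>
  The time to which a point of the punctured disc is lifted along the chain \<open>f z + t * z\<close>. The factor
  \<open>1 / \<bar>z\<bar>\<^sup>2 - 1\<close> in \<open>weight\<close> makes the extension of \<open>f z = z\<close> the identity if \<open>\<gamma> = 0\<close>.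
\<close>

definition height :: "complex \<Rightarrow> real" where
  "height z = weight z * cmod (deriv f z)"

text \<open>
  The function \<open>M = - z * (\<partial>h/\<partial>z)\<close> for \<open>h = height\<close>, written out.
\<close>

definition neg_log_grad :: "complex \<Rightarrow> complex" where
  "neg_log_grad z = of_real (cmod (deriv f z)) *
     (of_real (1 / (cos\<alpha> * (cmod z)\<^sup>2)) - of_real (weight z) * z * (deriv (deriv f) z / deriv f z) / 2)"

lemma weight_pos: "0 < weight z" if "z \<in> ball 0 1" "z \<noteq> 0"
proof -
  have "(cmod z)\<^sup>2 < 1" using that by (simp add: power_less_one_iff)
  then have "1 < 1 / (cmod z)\<^sup>2" using that by (simp add: less_divide_eq)
  then show ?thesis using cs by (simp add: weight_def)
qed

lemma height_pos: "0 < height z" if "z \<in> ball 0 1" "z \<noteq> 0"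
  using weight_pos[OF that] nonzero[OF that(1)] by (simp add: height_def)

text \<open>
  In Wirtinger notation \<open>dh = 2 * Re ((\<partial>h/\<partial>z) dz)\<close>.
\<close>

lemma height_has_derivative:
  assumes z: "z \<in> ball 0 1" "z \<noteq> 0"
  shows "(height has_derivative (\<lambda>v. - 2 * Re (neg_log_grad z * v / z))) (at z)"
proof -
  have n: "(norm has_derivative (\<lambda>v. inner v (sgn z))) (at z)"
    using has_derivative_norm[OF z(2)] by (simp add: inner_commute)
  have Dz: "inner v (sgn z) = cmod z * Re (v / z)" for v :: complex and z
  proof (cases "z = 0")
    case False
    have "v / z = v * cnj z / of_real ((cmod z)\<^sup>2)" using False by (subst complex_norm_square) simp
    then have "Re (v / z) = Re (v * cnj z) / (cmod z)\<^sup>2" by simp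
    also have "Re (v * cnj z) = inner v z" by (simp add: inner_complex_def)
    finally show ?thesis using False by (simp add: sgn_div_norm power2_eq_square field_simps)
  qed (simp add: sgn_zero)
  have n1: "(norm has_derivative (\<lambda>v. cmod z * Re (v / z))) (at z)"
    using n unfolding Dz .
  have w: "(weight has_derivative (\<lambda>v. - (2 * Re (v / z)) / (cos\<alpha> * (cmod z)\<^sup>2))) (at z)"
  proof -
    have "((\<lambda>r. (1 / r\<^sup>2 - 1) / cos\<alpha>) has_real_derivative - (2 / (cmod z) ^ 3) / cos\<alpha>) (at (cmod z))"
      using z cs by (auto intro!: derivative_eq_intros simp: power2_eq_square power3_eq_cube field_simps)
    from has_derivative_compose[OF n1 has_field_derivative_imp_has_derivative[OF this]]
    have "(weight has_derivative (\<lambda>v. - (2 / (cmod z) ^ 3) / cos\<alpha> * (cmod z * Re (v / z)))) (at z)"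
      by (simp add: weight_def[abs_def])
    moreover have "- (2 / (cmod z) ^ 3) / cos\<alpha> * (cmod z * Re (v / z)) = - (2 * Re (v / z)) / (cos\<alpha> * (cmod z)\<^sup>2)" for v
      using z cs by (simp add: power2_eq_square power3_eq_cube)
    ultimately show ?thesis by simp
  qed
  have "(deriv f has_field_derivative deriv (deriv f) z) (at z)"
    using holomorphic_derivI[OF deriv_hol _ z(1)] by simp
  then have d1: "(deriv f has_derivative (\<lambda>v. deriv (deriv f) z * v)) (at z)"
    by (simp add: has_field_derivative_def)
  have "(norm has_derivative (\<lambda>v. cmod (deriv f z) * Re (v / deriv f z))) (at (deriv f z))"
    using has_derivative_norm[OF nonzero[OF z(1)]] unfolding Dz[symmetric] by (simp add: inner_commute)
  from has_derivative_compose[OF d1 this]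
  have d: "((\<lambda>z. cmod (deriv f z)) has_derivative
      (\<lambda>v. cmod (deriv f z) * Re (deriv (deriv f) z * v / deriv f z))) (at z)" .
  have "(height has_derivative (\<lambda>v. weight z * (cmod (deriv f z) * Re (deriv (deriv f) z * v / deriv f z))
      + - (2 * Re (v / z)) / (cos\<alpha> * (cmod z)\<^sup>2) * cmod (deriv f z))) (at z)"
    unfolding height_def[abs_def] by (rule has_derivative_mult[OF w d])
  moreover have "weight z * (cmod (deriv f z) * Re (deriv (deriv f) z * v / deriv f z))
      + - (2 * Re (v / z)) / (cos\<alpha> * (cmod z)\<^sup>2) * cmod (deriv f z) = - 2 * Re (neg_log_grad z * v / z)" for v
  proof -
    have "neg_log_grad z * v / z = of_real (cmod (deriv f z) / (cos\<alpha> * (cmod z)\<^sup>2)) * (v / z)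
        - of_real (cmod (deriv f z) * weight z / 2) * (deriv (deriv f) z * v / deriv f z)"
      using z by (simp add: neg_log_grad_def field_simps)
    then have "Re (neg_log_grad z * v / z) = cmod (deriv f z) / (cos\<alpha> * (cmod z)\<^sup>2) * Re (v / z)
        - cmod (deriv f z) * weight z / 2 * Re (deriv (deriv f) z * v / deriv f z)"
      by (simp only: minus_complex.sel Re_of_real_mult)
    then show ?thesis by (simp add: field_simps)
  qed
  ultimately show ?thesis by simp
qed

text \<open>
  Let \<open>M = neg_log_grad z\<close>, \<open>h = height z\<close>, \<open>q = 1 / \<bar>z\<bar>\<close> and \<open>t = arg f'\<close>. Then \<open>M = \<bar>f'\<bar> / cos \<alpha> * q * (q + W)\<close> and
  \<open>f' + h - M = - \<bar>f'\<bar> / cos \<alpha> * (1 - cos \<alpha> * cis t + q * W)\<close>. The Schwarz-Pick bound makes \<open>W\<close> admissible in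
  \<open>dilatation_inequality\<close>.
\<close>

lemma neg_log_grad_bounds:
  assumes z: "z \<in> ball 0 1" "z \<noteq> 0"
  shows "cmod (deriv f z + of_real (height z) - neg_log_grad z) \<le> sin\<alpha> * cmod (neg_log_grad z)"
    and "(cmod z)\<^sup>2 * cmod (neg_log_grad z) \<le> 2 / cos\<alpha> * cmod (deriv f z)"
proof -
  define r q t where "r = cmod z" and "q = 1 / r" and "t = Arg (deriv f z)"
  define B where "B = deriv (deriv f) z / deriv f z"
  \<comment> \<open>chosen so that \<open>neg_log_grad z = \<bar>f'\<bar> / cos \<alpha> * q * (q + W)\<close>\<close>
  define W where "W = - (of_real (cos\<alpha> * weight z * r) * z * B / 2)"
  have r: "0 < r" "r < 1" using z by (auto simp: r_def)
  have r2: "r\<^sup>2 < 1" using r by (simp add: power_less_one_iff)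
  have q: "1 \<le> q" using r by (simp add: q_def)
  have cw: "cos\<alpha> * weight z = q\<^sup>2 - 1" using cs by (simp add: weight_def q_def r_def power_divide)
  have cwr: "cos\<alpha> * weight z * r\<^sup>2 = 1 - r\<^sup>2" unfolding cw q_def using r by (simp add: power_divide field_simps)
  have "0 < weight z" by (rule weight_pos[OF z])
  have W: "cmod W \<le> \<gamma> * cos (t / \<gamma>)"
  proof -
    have "cmod W = cos\<alpha> * weight z * r\<^sup>2 * cmod B / 2"
      using cs \<open>0 < weight z\<close> r by (simp add: W_def norm_mult norm_divide r_def[symmetric] power2_eq_square)
    also have "\<dots> \<le> (1 - r\<^sup>2) * (2 * (\<gamma> * cos (t / \<gamma>)) / (1 - r\<^sup>2)) / 2"
    proof -
      have "cmod B \<le> 2 * (\<gamma> * cos (t / \<gamma>)) / (1 - r\<^sup>2)"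
        using pre_Schwarzian_bound[OF z(1)] by (simp only: B_def t_def r_def)
      then show ?thesis unfolding cwr using r2 by (intro divide_right_mono mult_left_mono) auto
    qed
    finally show ?thesis using r2 by simp
  qed
  have dil: "cmod ((1 - of_real cos\<alpha> * cis t) + of_real q * W) \<le> sin\<alpha> * q * cmod (of_real q + W)"
    using dilatation_inequality[OF gamma Arg_le[OF z(1)] _ q, of W] W
    unfolding cos\<alpha>_def sin\<alpha>_def t_def by simp
  have qr: "of_real q * of_real r = (1::complex)" using r by (simp add: q_def flip: of_real_mult)
  have qW: "of_real q * W = - (of_real (cos\<alpha> * weight z) * z * B / 2)"
  proof -
    have "of_real q * W = (of_real q * of_real r) * - (of_real (cos\<alpha> * weight z) * z * B / 2)"
      by (simp add: W_def algebra_simps)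
    then show ?thesis by (simp add: qr)
  qed
  have neg_log_grad: "neg_log_grad z = of_real (cmod (deriv f z) / cos\<alpha>) * (of_real q * (of_real q + W))"
  proof -
    have "of_real q * (of_real q + W) = of_real (q\<^sup>2) - of_real (cos\<alpha> * weight z) * z * B / 2"
      by (simp add: distrib_left qW power2_eq_square)
    also have "\<dots> = of_real cos\<alpha> * (of_real (1 / (cos\<alpha> * r\<^sup>2)) - of_real (weight z) * z * B / 2)"
      using cs r by (simp add: q_def power_divide field_simps)
    finally show ?thesis using cs by (simp add: neg_log_grad_def r_def B_def)
  qed
  have fp: "deriv f z = of_real (cmod (deriv f z)) * cis t"
    using rcis_cmod_Arg[of "deriv f z"] by (simp add: rcis_def t_def)
  have P: "deriv f z + of_real (height z) - neg_log_grad z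
      = - (of_real (cmod (deriv f z) / cos\<alpha>) * ((1 - of_real cos\<alpha> * cis t) + of_real q * W))"
  proof -
    define \<rho> where "\<rho> = complex_of_real (cmod (deriv f z))"
    have h: "of_real (height z) = \<rho> * (of_real (q\<^sup>2) - 1) / of_real cos\<alpha>"
    proof -
      have "weight z = (q\<^sup>2 - 1) / cos\<alpha>" using cw cs by (simp add: eq_divide_eq mult.commute)
      then have "height z = cmod (deriv f z) * (q\<^sup>2 - 1) / cos\<alpha>" by (simp add: height_def)
      then show ?thesis by (simp add: \<rho>_def)
    qed
    have "deriv f z + of_real (height z) - neg_log_grad z
      = \<rho> * cis t + \<rho> * (of_real (q\<^sup>2) - 1) / of_real cos\<alpha> - \<rho> / of_real cos\<alpha> * (of_real q * (of_real q + W))"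
      unfolding h neg_log_grad using fp by (simp add: \<rho>_def)
    also have "\<dots> = - (\<rho> / of_real cos\<alpha> * ((1 - of_real cos\<alpha> * cis t) + of_real q * W))"
      using cs by (simp add: field_simps power2_eq_square)
    finally show ?thesis by (simp add: \<rho>_def)
  qed
  have "cmod (deriv f z + of_real (height z) - neg_log_grad z)
      = cmod (deriv f z) / cos\<alpha> * cmod ((1 - of_real cos\<alpha> * cis t) + of_real q * W)"
    unfolding P using cs by (simp add: norm_mult norm_divide)
  also have "\<dots> \<le> cmod (deriv f z) / cos\<alpha> * (sin\<alpha> * q * cmod (of_real q + W))"
    using cs by (intro mult_left_mono dil) auto
  also have "\<dots> = sin\<alpha> * cmod (neg_log_grad z)" unfolding neg_log_grad using cs q by (simp add: norm_mult norm_divide)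
  finally show "cmod (deriv f z + of_real (height z) - neg_log_grad z) \<le> sin\<alpha> * cmod (neg_log_grad z)" .
  have "cmod W \<le> \<gamma> * 1" using W gamma by (meson cos_le_one mult_left_mono order_trans)
  then have "cmod (of_real q + W) \<le> 2 * q"
    using norm_triangle_ineq[of "of_real q" W] q gamma by simp
  then have "cmod (neg_log_grad z) \<le> cmod (deriv f z) / cos\<alpha> * (q * (2 * q))"
    unfolding neg_log_grad norm_mult using cs q by (intro mult_mono) (auto simp: norm_mult norm_divide)
  then have "r\<^sup>2 * cmod (neg_log_grad z) \<le> r\<^sup>2 * (cmod (deriv f z) / cos\<alpha> * (q * (2 * q)))" by (intro mult_left_mono) auto
  also have "\<dots> = 2 / cos\<alpha> * cmod (deriv f z)" using r by (simp add: q_def power2_eq_square)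
  finally show "(cmod z)\<^sup>2 * cmod (neg_log_grad z) \<le> 2 / cos\<alpha> * cmod (deriv f z)" by (simp add: r_def)
qed

text \<open>
  Along the trajectory \<open>Z\<close> of the value \<open>f w + \<sigma> * w\<close> the derivative of
  \<open>height (Z \<tau>) - \<tau>\<close>, with \<open>M = neg_log_grad (Z \<tau>)\<close> and \<open>f' = deriv f (Z \<tau>)\<close>, is \<open>2 * Re (M / (f' + \<tau>)) - 1\<close>.
  At a zero, \<open>\<tau>\<close> is the height, so by \<open>neg_log_grad_bounds\<close> the distance of \<open>f' + \<tau>\<close> from \<open>M\<close> is less
  than \<open>\<bar>M\<bar>\<close>; this says exactly that \<open>Re (M / (f' + \<tau>)) > 1/2\<close>.
\<close>

lemma height_crosses_upwards:
  assumes w: "w \<in> ball 0 1" "w \<noteq> 0" and st: "0 \<le> \<sigma>" "\<sigma> < t" and start: "\<sigma> \<le> height w"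
    and z: "z \<in> ball 0 1" "f z + of_real t * z = f w + of_real \<sigma> * w"
  shows "t < height z"
proof -
  obtain Z where Z: "Z \<sigma> = w"
    "\<And>\<tau>. \<tau> \<in> {\<sigma>..t} \<Longrightarrow> Z \<tau> \<in> ball 0 1 - {0} \<and> f (Z \<tau>) + of_real \<tau> * Z \<tau> = f w + of_real \<sigma> * w"
    "\<And>\<tau>. \<tau> \<in> {\<sigma>..t} \<Longrightarrow> (Z has_vector_derivative - Z \<tau> / (deriv f (Z \<tau>) + of_real \<tau>)) (at \<tau> within {\<sigma>..t})"
    using chain_trajectory[OF w st(1) less_imp_le[OF st(2)]] by metis
  have "0 < height (Z t) - t"
  proof (rule positive_after_upcrossings[OF st(2), of "\<lambda>\<tau>. height (Z \<tau>) - \<tau>"])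
    show "0 \<le> height (Z \<sigma>) - \<sigma>" using Z(1) start by simp
    fix \<tau> assume tau: "\<tau> \<in> {\<sigma>..t}"
    define \<zeta> where "\<zeta> = Z \<tau>"
    have zeta: "\<zeta> \<in> ball 0 1" "\<zeta> \<noteq> 0" using Z(2)[OF tau] by (auto simp: \<zeta>_def)
    define e where "e = - \<zeta> / (deriv f \<zeta> + of_real \<tau>)"
    have "(Z has_derivative (\<lambda>x. x *\<^sub>R e)) (at \<tau> within {\<sigma>..t})"
      using Z(3)[OF tau] unfolding has_vector_derivative_def \<zeta>_def e_def .
    from has_derivative_compose[OF this height_has_derivative[OF zeta, unfolded \<zeta>_def]]
    have hd: "((\<lambda>\<tau>. height (Z \<tau>)) has_derivative (\<lambda>x. - 2 * Re (neg_log_grad \<zeta> * (x *\<^sub>R e) / \<zeta>))) (at \<tau> within {\<sigma>..t})"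
      by (simp add: \<zeta>_def)
    have slope: "- 2 * Re (neg_log_grad \<zeta> * (x *\<^sub>R e) / \<zeta>) = (2 * Re (neg_log_grad \<zeta> / (deriv f \<zeta> + of_real \<tau>))) * x" for x
    proof -
      have "neg_log_grad \<zeta> * (x *\<^sub>R e) / \<zeta> = of_real (- x) * (neg_log_grad \<zeta> / (deriv f \<zeta> + of_real \<tau>))"
        using zeta by (simp add: e_def scaleR_conv_of_real)
      then show ?thesis by (simp only: Re_of_real_mult)  simp
    qed
    have d: "((\<lambda>\<tau>. height (Z \<tau>)) has_real_derivative 2 * Re (neg_log_grad \<zeta> / (deriv f \<zeta> + of_real \<tau>)))
        (at \<tau> within {\<sigma>..t})"
      using hd unfolding has_field_derivative_def slope .
    have "((\<lambda>\<tau>. height (Z \<tau>) - \<tau>) has_real_derivative 2 * Re (neg_log_grad \<zeta> / (deriv f \<zeta> + of_real \<tau>)) - 1)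
        (at \<tau> within {\<sigma>..t})"
      by (intro DERIV_diff d DERIV_ident)
    moreover have "0 < 2 * Re (neg_log_grad \<zeta> / (deriv f \<zeta> + of_real \<tau>)) - 1" if "height \<zeta> = \<tau>"
    proof -
      define p where "p = deriv f \<zeta> + of_real \<tau>"
      have "0 < Re p" using Re_deriv_pos[OF zeta(1)] tau st by (simp add: p_def)
      then have p0: "p \<noteq> 0" by auto
      have le: "cmod (p - neg_log_grad \<zeta>) \<le> sin\<alpha> * cmod (neg_log_grad \<zeta>)"
        using neg_log_grad_bounds(1)[OF zeta] that by (simp add: p_def)
      then have "neg_log_grad \<zeta> \<noteq> 0" using p0 by auto
      then have "sin\<alpha> * cmod (neg_log_grad \<zeta>) < 1 * cmod (neg_log_grad \<zeta>)" using cs by (intro mult_strict_right_mono) auto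
      with le have "(cmod (p - neg_log_grad \<zeta>))\<^sup>2 < (cmod (neg_log_grad \<zeta>))\<^sup>2" by (intro power_strict_mono) auto
      then have lt: "(cmod p)\<^sup>2 < 2 * Re (neg_log_grad \<zeta> * cnj p)"
        unfolding cmod_power2 by (simp add: algebra_simps power2_eq_square)
      have "neg_log_grad \<zeta> / p = neg_log_grad \<zeta> * cnj p / of_real ((cmod p)\<^sup>2)"
        using p0 by (subst complex_norm_square) simp
      then have eq: "Re (neg_log_grad \<zeta> / p) = Re (neg_log_grad \<zeta> * cnj p) / (cmod p)\<^sup>2" by simp
      have n0: "0 < (cmod p)\<^sup>2" using p0 by simp
      have "1 < 2 * Re (neg_log_grad \<zeta> * cnj p) / (cmod p)\<^sup>2"
        unfolding pos_less_divide_eq[OF n0] using lt by linarith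
      then show ?thesis unfolding p_def[symmetric] eq by linarith
    qed
    ultimately show "\<exists>d. ((\<lambda>\<tau>. height (Z \<tau>) - \<tau>) has_real_derivative d) (at \<tau> within {\<sigma>..t})
        \<and> (height (Z \<tau>) - \<tau> = 0 \<longrightarrow> 0 < d)"
      unfolding \<zeta>_def by (intro exI[of _ "2 * Re (neg_log_grad (Z \<tau>) / (deriv f (Z \<tau>) + of_real \<tau>)) - 1"]) simp
  qed
  moreover have "Z t = z"
  proof (rule chain_inj[OF _ z(1)])
    have "t \<in> {\<sigma>..t}" using st by simp
    from Z(2)[OF this] show "Z t \<in> ball 0 1" "f (Z t) + of_real t * Z t = f z + of_real t * z"
      unfolding z(2) by blast+
  qed (use st in linarith)
  ultimately show ?thesis by simp
qed

text \<open>
  The extension outside the disc, in the reflected coordinate \<open>z = 1 / cnj w\<close>.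
\<close>

definition outer :: "complex \<Rightarrow> complex" where
  "outer z = closed_ext z + of_real (height z) * z"

definition extension :: "complex \<Rightarrow> complex" where
  "extension w = (if cmod w \<le> 1 then closed_ext w else outer (1 / cnj w))"

lemma outer_eq: "outer z = f z + of_real (height z) * z" if "z \<in> ball 0 1"
  by (simp add: outer_def closed_ext(2)[OF that])

text \<open>
  If two points had the same image, the larger height would be the second time at which the
  trajectory meets its height, against \<open>height_crosses_upwards\<close>.
\<close>

lemma inj_outer: "inj_on outer (ball 0 1 - {0})"
proof (rule inj_onI)
  have less: False if "z \<in> ball 0 1 - {0}" "w \<in> ball 0 1 - {0}" "outer z = outer w" "height w < height z" for z w
    using height_crosses_upwards[of w "height w" "height z" z] that height_pos[of w]
    by (auto simp: outer_eq)
  fix z w assume zw: "z \<in> ball 0 1 - {0}" "w \<in> ball 0 1 - {0}" "outer z = outer w"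
  then have "height z = height w" using less[of z w] less[of w z] by force
  then show "z = w"
    using zw chain_inj[of z w "height w"] height_pos[of w] by (auto simp: outer_eq)
qed

text \<open>
  A value \<open>f w\<close> starts its trajectory at time 0 below the positive height of \<open>w\<close>, and so stays below the
  height at all later times.
\<close>

lemma outer_notin_image_ball:
  assumes z: "z \<in> ball 0 1 - {0}"
  shows "outer z \<notin> f ` ball 0 1"
proof
  assume "outer z \<in> f ` ball 0 1"
  then obtain w where w: "w \<in> ball 0 1" "f z + of_real (height z) * z = f w + of_real 0 * w"
    using z by (auto simp: outer_eq)
  have h: "0 < height z" using z by (intro height_pos) auto
  show False
  proof (cases "w = 0")
    case True
    then have "f z + of_real (height z) * z = f 0 + of_real (height z) * 0" using w(2) by simp
    then show False using chain_inj[of z 0 "height z"] z h by auto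
  next
    case False
    then show False
      using height_crosses_upwards[of w 0 "height z" z] w h height_pos[OF w(1) False] z by auto
  qed
qed

lemma height_continuous: "continuous_on (ball 0 1 - {0}) height"
  using height_has_derivative
  by (intro continuous_at_imp_continuous_on ballI has_derivative_continuous) blast

text \<open>
  The height is at most of order \<open>(1 - \<bar>z\<bar>) * (1 - \<bar>z\<bar>) powr (- \<gamma>)\<close> near the circle, and \<open>\<gamma> < 1\<close>.
\<close>

lemma height_at_boundary: "continuous (at u within cball 0 1) height" if "cmod u = 1"
proof -
  have h0: "height u = 0" using that by (simp add: height_def weight_def)
  have "(height \<longlongrightarrow> 0) (at u within cball 0 1)"
  proof (rule Lim_null_comparison)
    define b where "b z = (1 + cmod z) / (cos\<alpha> * (cmod z)\<^sup>2) * (2 powr \<gamma> * (1 - cmod z) powr (1 - \<gamma>))" for z :: complex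
    have "\<forall>\<^sub>F z in at u. z \<noteq> 0" using that by (intro eventually_neq_at_within) 
    then have "\<forall>\<^sub>F z in at u within cball 0 1. z \<noteq> 0"
      using at_le[of "cball 0 1" UNIV u] filter_leD by blast
    moreover have "\<forall>\<^sub>F z in at u within cball 0 1. z \<in> cball 0 1"
      unfolding eventually_at_filter by simp
    ultimately show "\<forall>\<^sub>F z in at u within cball 0 1. norm (height z) \<le> b z"
    proof eventually_elim
      case (elim z)
      show ?case
      proof (cases "cmod z = 1")
        case True
        then show ?thesis by (simp add: height_def weight_def b_def)
      next
        case False
        then have z: "z \<in> ball 0 1" using elim by simp
        then have z1: "cmod z < 1" by simp
        have "norm (height z) = weight z * cmod (deriv f z)" using height_pos[OF z] elim by (simp add: height_def)
        also have "\<dots> \<le> weight z * (2 / (1 - cmod z)) powr \<gamma>"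
          using weight_pos[OF z] elim deriv_growth[OF z] by (intro mult_left_mono) auto
        also have "(2 / (1 - cmod z)) powr \<gamma> = 2 powr \<gamma> * (1 - cmod z) powr (1 - \<gamma>) / (1 - cmod z)"
          using z1 by (simp add: powr_divide powr_diff)
        also have "weight z * \<dots> = b z"
        proof -
          have "weight z = (1 + cmod z) / (cos\<alpha> * (cmod z)\<^sup>2) * (1 - cmod z)"
            using elim cs unfolding weight_def by (simp add: field_simps power2_eq_square)
          then show ?thesis using z1 unfolding b_def by simp
        qed
        finally show ?thesis .
      qed
    qed
    have "(b \<longlongrightarrow> (1 + cmod u) / (cos\<alpha> * (cmod u)\<^sup>2) * (2 powr \<gamma> * 0)) (at u within cball 0 1)"
      unfolding b_def
    proof (intro tendsto_intros)
      show "((\<lambda>z. (1 - cmod z) powr (1 - \<gamma>)) \<longlongrightarrow> 0) (at u within cball 0 1)"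
      proof (rule tendsto_zero_powrI)
        have "((\<lambda>z. 1 - cmod z) \<longlongrightarrow> 1 - cmod u) (at u within cball 0 1)" by (intro tendsto_intros)
        then show "((\<lambda>z. 1 - cmod z) \<longlongrightarrow> 0) (at u within cball 0 1)" using that by simp
        show "\<forall>\<^sub>F z in at u within cball 0 1. 0 \<le> 1 - cmod z"
          unfolding eventually_at_filter by simp
      qed (use gamma in auto)
    qed (use that cs in auto)
    then show "(b \<longlongrightarrow> 0) (at u within cball 0 1)" by simp
  qed
  then show ?thesis by (simp add: continuous_within h0)
qed

lemma outer_continuous: "continuous_on (cball 0 1 - {0}) outer"
proof -
  have "continuous_on (cball 0 1 - {0}) height"
    unfolding continuous_on_eq_continuous_within
  proof
    fix u :: complex assume u: "u \<in> cball 0 1 - {0}"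
    show "continuous (at u within cball 0 1 - {0}) height"
    proof (cases "cmod u = 1")
      case True
      then show ?thesis using height_at_boundary continuous_within_subset by blast
    next
      case False
      then have "u \<in> ball 0 1" "u \<noteq> 0" using u by auto
      then show ?thesis
        using has_derivative_continuous[OF height_has_derivative] continuous_at_imp_continuous_at_within by blast
    qed
  qed
  moreover have "continuous_on (cball 0 1 - {0}) closed_ext"
    using closed_ext(1) by (rule continuous_on_subset) auto
  ultimately show ?thesis unfolding outer_def by (intro continuous_intros)
qed

lemma extension_continuous: "continuous_on UNIV extension"
proof -
  have "continuous_on (cball 0 1 \<union> {w. 1 \<le> cmod w}) extension"
    unfolding extension_def
  proof (rule continuous_on_If)
    show "closed {w::complex. 1 \<le> cmod w}" by (intro closed_Collect_le continuous_intros)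
    show "continuous_on {w. 1 \<le> cmod w} (\<lambda>w. outer (1 / cnj w))"
    proof (rule continuous_on_compose2[OF outer_continuous])
      show "continuous_on {w. 1 \<le> cmod w} (\<lambda>w. 1 / cnj w)" by (intro continuous_intros) auto
      show "(\<lambda>w. 1 / cnj w) ` {w. 1 \<le> cmod w} \<subseteq> cball 0 1 - {0}"
        by (auto simp: norm_divide divide_le_eq_1)
    qed
    \<comment> \<open>on the circle \<open>1 / cnj w = w\<close> and \<open>weight w = 0\<close>, so the two formulas agree\<close>
    fix w :: complex assume w: "w \<in> {w. 1 \<le> cmod w}" "cmod w \<le> 1"
    then have w1: "cmod w = 1" by simp
    then have "w * cnj w = 1" using complex_norm_square[of w] by simp
    then have "1 / cnj w = w" by (metis mult_eq_0_iff nonzero_divide_eq_eq zero_neq_one)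
    then show "closed_ext w = outer (1 / cnj w)" using w1 by (simp add: outer_def height_def weight_def)
  next
    fix w :: complex assume "w \<in> cball 0 1" "\<not> cmod w \<le> 1"
    then show "closed_ext w = outer (1 / cnj w)" by simp
  qed (auto intro: closed_ext(1))
  moreover have "cball 0 1 \<union> {w::complex. 1 \<le> cmod w} = UNIV" by auto
  ultimately show ?thesis by simp
qed

text \<open>
  The images of the disc and of the exterior are disjoint by \<open>outer_notin_image_ball\<close>. By invariance
  of domain the image of the exterior is open; if it contained the image of a point on the circle, it would
  contain images of nearby points of the disc.
\<close>

lemma extension_inj: "inj extension"
proof -
  have out: "inj_on extension (- cball 0 1)"
  proof (rule inj_onI)
    fix w u assume wu: "w \<in> - cball 0 1" "u \<in> - cball 0 1" "extension w = extension u"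
    then have "outer (1 / cnj w) = outer (1 / cnj u)" by (simp add: extension_def)
    then have "1 / cnj w = 1 / cnj u"
      using inj_onD[OF inj_outer] inverse_cnj_bij(2) wu(1,2) by blast
    then show "w = u" using inj_onD[OF inverse_cnj_bij(1)] wu(1,2) by blast
  qed
  have op: "open (extension ` (- cball 0 1))"
    using out by (intro invariance_of_domain continuous_on_subset[OF extension_continuous]) auto
  have mixed: "extension w \<noteq> extension u" if w: "w \<in> - cball 0 1" and u: "u \<in> cball 0 1" for w u
  proof
    assume eq: "extension w = extension u"
    have "extension u \<in> extension ` (- cball 0 1)" unfolding eq[symmetric] using w by (rule imageI)
    then have "u \<in> extension -` (extension ` (- cball 0 1))" by simp
    moreover have "open (extension -` (extension ` (- cball 0 1)))"
      using op extension_continuous by (simp add: open_vimage)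
    moreover have "u \<in> closure (ball 0 1)" using u by simp
    ultimately obtain v where v: "v \<in> ball 0 1" "extension v \<in> extension ` (- cball 0 1)"
      by (meson closure_iff_nhds_not_empty disjoint_iff vimageE open_Int_closure_eq_empty)
    then obtain x where x: "x \<in> - cball 0 1" "extension v = extension x" by blast
    then have "outer (1 / cnj x) = f v" using v closed_ext(2) by (simp add: extension_def)
    then show False
      using outer_notin_image_ball[OF inverse_cnj_bij(2)[OF x(1)]] v(1) by blast
  qed
  show ?thesis
  proof (rule injI)
    fix w u assume eq: "extension w = extension u"
    consider "w \<in> cball 0 1" "u \<in> cball 0 1" | "w \<in> - cball 0 1" "u \<in> - cball 0 1"
      using mixed[of w u] mixed[of u w] eq by fastforce
    then show "w = u"
    proof cases
      case 1
      then show ?thesis using inj_onD[OF inj_closed_ext] eq by (simp add: extension_def)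
    next
      case 2
      then show ?thesis using inj_onD[OF out] eq by blast
    qed
  qed
qed

text \<open>
  Near 0 the height is at least a multiple of \<open>1 / \<bar>z\<bar>\<^sup>2\<close>, while \<open>f\<close> is bounded there.
\<close>

lemma extension_norm_at_infinity:
  obtains R where "\<And>w. R \<le> cmod w \<Longrightarrow> B \<le> cmod (extension w)"
proof -
  obtain \<mu> where mu: "0 < \<mu>" "\<And>z. cmod z \<le> 1/2 \<Longrightarrow> \<mu> \<le> Re (deriv f z)"
    by (rule Re_increment_ge[of "1/2"]) (simp, blast)
  have "compact (f ` cball 0 (1/2))"
    by (intro compact_continuous_image holomorphic_on_imp_continuous_on holomorphic_on_subset[OF hol]) auto
  then obtain K where K: "\<And>z. cmod z \<le> 1/2 \<Longrightarrow> cmod (f z) \<le> K"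
    by (metis bounded_iff compact_imp_bounded imageI mem_cball_0)
  have "B \<le> cmod (extension w)" if w: "2 + (B + K) / \<mu> \<le> cmod w" "2 \<le> cmod w" for w
  proof -
    define z where "z = 1 / cnj w"
    have zw: "cmod z = 1 / cmod w" by (simp add: z_def norm_divide)
    have z2: "cmod z \<le> 1/2" unfolding zw by (rule divide_left_mono) (use w(2) in auto)
    have zb: "z \<in> ball 0 1" "z \<noteq> 0" using z2 w(2) by (auto simp: z_def)
    have "\<mu> * (cmod w - 1) \<le> height z * cmod z"
    proof -
      have "\<mu> \<le> cmod (deriv f z)" using mu(2)[OF z2] complex_Re_le_cmod order_trans by blast
      moreover have "cmod w - 1 \<le> weight z * cmod z"
      proof -
        have w0: "0 < cmod w" using w(2) by linarith
        have "cos\<alpha> * (cmod w - 1) \<le> 1 * (cmod w - 1)" using cs w(2) by (intro mult_right_mono) auto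
        also have "\<dots> \<le> cmod w - 1 / cmod w" using w0 w(2) by simp
        also have "\<dots> = cos\<alpha> * (weight z * cmod z)"
          using w0 cs by (simp add: weight_def zw field_simps power2_eq_square)
        finally show ?thesis using cs by simp
      qed
      ultimately have "\<mu> * (cmod w - 1) \<le> cmod (deriv f z) * (weight z * cmod z)"
        using w(2) mu(1) by (intro mult_mono) auto
      then show ?thesis by (simp add: height_def mult_ac)
    qed
    moreover have "B + K \<le> \<mu> * (cmod w - 1)"
    proof -
      have "(B + K) / \<mu> \<le> cmod w - 1" using w(1) by simp
      then show ?thesis using mu(1) by (simp add: pos_divide_le_eq mult.commute)
    qed
    moreover have "height z * cmod z = cmod (of_real (height z) * z)"
      using height_pos[OF zb] by (simp add: norm_mult)
    moreover have "cmod (of_real (height z) * z) - cmod (f z) \<le> cmod (extension w)"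
      using norm_diff_ineq[of "of_real (height z) * z" "f z"] w(2) zb
      by (simp add: extension_def z_def[symmetric] outer_eq add.commute)
    ultimately show ?thesis using K[OF z2] by linarith
  qed
  then show ?thesis by (intro that[of "max 2 (2 + (B + K) / \<mu>)"]) auto
qed

text \<open>
  The range is open by invariance of domain, and closed because the extension is proper.
\<close>

lemma extension_surj: "range extension = UNIV"
proof -
  have "open (range extension)" using extension_continuous extension_inj by (intro invariance_of_domain) auto
  moreover have "closed (range extension)"
    unfolding closure_subset_eq[symmetric]
  proof
    fix y assume y: "y \<in> closure (range extension)"
    obtain R where R: "\<And>w. R \<le> cmod w \<Longrightarrow> cmod y + 1 \<le> cmod (extension w)"
      using extension_norm_at_infinity by blast
    have "range extension \<inter> ball y 1 \<subseteq> extension ` cball 0 R"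
    proof safe
      fix w assume "extension w \<in> ball y 1"
      then have "cmod (extension w) < cmod y + 1"
        using norm_triangle_ineq2[of "extension w" y] by (simp add: dist_norm norm_minus_commute)
      then have "cmod w < R" using R[of w] by force
      then show "extension w \<in> extension ` cball 0 R" by auto
    qed
    moreover have "compact (extension ` cball 0 R)"
      by (intro compact_continuous_image continuous_on_subset[OF extension_continuous]) auto
    moreover have "y \<in> closure (range extension \<inter> ball y 1)"
      using y open_Int_closure_subset[of "ball y 1" "range extension"] by (auto simp: Int_commute)
    ultimately have "y \<in> extension ` cball 0 R"
      by (meson closure_minimal compact_imp_closed subsetD)
    then show "y \<in> range extension" by blast
  qed
  ultimately show ?thesis using clopen[of "range extension"] by auto
qed

text \<open>
  The Wirtinger derivatives of the extension off the unit circle; on the circle they are set to 0.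
\<close>

definition ext_z :: "complex \<Rightarrow> complex" where
  "ext_z w = indicator (ball 0 1) w *\<^sub>R deriv f w
    + indicator (- cball 0 1) w *\<^sub>R (of_real ((cmod (1 / cnj w))\<^sup>2) * cnj (neg_log_grad (1 / cnj w)))"

definition ext_zbar :: "complex \<Rightarrow> complex" where
  "ext_zbar w = indicator (- cball 0 1) w *\<^sub>R
     (- ((1 / cnj w)\<^sup>2 * (deriv f (1 / cnj w) + of_real (height (1 / cnj w)) - neg_log_grad (1 / cnj w))))"

text \<open>
  Outside the disc the extension is \<open>outer\<close> after the anticonformal map \<open>1 / cnj w\<close>, which
  interchanges the two Wirtinger derivatives of \<open>outer\<close> up to factors of modulus \<open>\<bar>z\<bar>\<^sup>2\<close>.
\<close>

lemma extension_has_derivative: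
  assumes "cmod w \<noteq> 1"
  shows "(extension has_derivative (\<lambda>v. ext_z w * v + ext_zbar w * cnj v)) (at w)"
proof (cases "cmod w < 1")
  case True
  then have w: "w \<in> ball 0 1" by simp
  have "(extension has_field_derivative deriv f w) (at w)"
    by (rule has_field_derivative_transform_within_open[OF f_deriv[OF w] open_ball w])
      (simp add: extension_def closed_ext(2))
  then show ?thesis using True by (simp add: has_field_derivative_def ext_z_def ext_zbar_def)
next
  case False
  then have w: "w \<in> - cball 0 1" using assms by simp
  then have w0: "cnj w \<noteq> 0" by auto
  define z where "z = 1 / cnj w"
  have z: "z \<in> ball 0 1" "z \<noteq> 0" using inverse_cnj_bij(2)[OF w] by (auto simp: z_def)
  have "((\<lambda>w. 1 / cnj w) has_derivative (\<lambda>v. - (z\<^sup>2 * cnj v))) (at w)"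
  proof -
    have "((\<lambda>u. 1 / u) has_derivative (*) (- (z\<^sup>2))) (at (cnj w))"
    proof -
      have "((\<lambda>u. 1 / u) has_field_derivative - (z\<^sup>2)) (at (cnj w))"
        using w0 by (auto intro!: derivative_eq_intros simp: z_def power2_eq_square)
      then show ?thesis by (rule has_field_derivative_imp_has_derivative)
    qed
    from has_derivative_compose[OF has_derivative_cnj[OF has_derivative_ident] this]
    show ?thesis by simp
  qed
  moreover have "(outer has_derivative (\<lambda>v. deriv f z * v
      + (of_real (height z) * v + of_real (- 2 * Re (neg_log_grad z * v / z)) * z))) (at (1 / cnj w))"
  proof -
    have "((\<lambda>z. f z + of_real (height z) * z) has_derivative (\<lambda>v. deriv f z * v
      + (of_real (height z) * v + of_real (- 2 * Re (neg_log_grad z * v / z)) * z))) (at z)"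
      by (rule has_derivative_add[OF has_field_derivative_imp_has_derivative[OF f_deriv[OF z(1)]]
            has_derivative_mult[OF has_derivative_of_real[OF height_has_derivative[OF z]] has_derivative_ident]])
    then have "(outer has_derivative (\<lambda>v. deriv f z * v
      + (of_real (height z) * v + of_real (- 2 * Re (neg_log_grad z * v / z)) * z))) (at z)"
      by (rule has_derivative_transform_within_open[OF _ open_ball z(1)]) (simp add: outer_eq)
    then show ?thesis by (simp add: z_def)
  qed
  ultimately have "((\<lambda>w. outer (1 / cnj w)) has_derivative (\<lambda>v. deriv f z * (- (z\<^sup>2 * cnj v))
      + (of_real (height z) * (- (z\<^sup>2 * cnj v)) + of_real (- 2 * Re (neg_log_grad z * (- (z\<^sup>2 * cnj v)) / z)) * z))) (at w)"
    by (rule has_derivative_compose)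
  moreover have "deriv f z * (- (z\<^sup>2 * cnj v))
      + (of_real (height z) * (- (z\<^sup>2 * cnj v)) + of_real (- 2 * Re (neg_log_grad z * (- (z\<^sup>2 * cnj v)) / z)) * z)
      = ext_z w * v + ext_zbar w * cnj v" for v
  proof -
    define X where "X = neg_log_grad z * z * cnj v"
    have "neg_log_grad z * (- (z\<^sup>2 * cnj v)) / z = - X" using z by (simp add: X_def power2_eq_square)
    then have "complex_of_real (- 2 * Re (neg_log_grad z * (- (z\<^sup>2 * cnj v)) / z)) = of_real (2 * Re X)" by simp
    also have "\<dots> = X + cnj X" by (simp only: complex_add_cnj)
    finally have e1: "complex_of_real (- 2 * Re (neg_log_grad z * (- (z\<^sup>2 * cnj v)) / z)) * z
        = neg_log_grad z * z\<^sup>2 * cnj v + cnj (neg_log_grad z) * (z * cnj z) * v"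
      by (simp add: X_def algebra_simps power2_eq_square)
    have e2: "z * cnj z = of_real ((cmod z)\<^sup>2)" by (rule complex_norm_square[symmetric])
    have e3: "ext_z w = of_real ((cmod z)\<^sup>2) * cnj (neg_log_grad z)"
      using w by (simp add: ext_z_def z_def)
    have e4: "ext_zbar w = - (z\<^sup>2 * (deriv f z + of_real (height z) - neg_log_grad z))"
      using w by (simp add: ext_zbar_def z_def)
    show ?thesis unfolding e1 e2 e3 e4 by (simp add: algebra_simps)
  qed
  ultimately have "((\<lambda>w. outer (1 / cnj w)) has_derivative (\<lambda>v. ext_z w * v + ext_zbar w * cnj v)) (at w)"
    by simp
  moreover have "open (- cball (0::complex) 1)" by auto
  ultimately show ?thesis
    by (rule has_derivative_transform_within_open[OF _ _ w]) (simp add: extension_def)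
qed

lemma ext_zbar_le: "cmod (ext_zbar w) \<le> sin\<alpha> * cmod (ext_z w)"
proof (cases "w \<in> - cball 0 1")
  case True
  define z where "z = 1 / cnj w"
  have z: "z \<in> ball 0 1" "z \<noteq> 0" using inverse_cnj_bij(2)[OF True] by (auto simp: z_def)
  have "cmod (ext_zbar w) = (cmod z)\<^sup>2 * cmod (deriv f z + of_real (height z) - neg_log_grad z)"
    using True by (simp add: ext_zbar_def z_def norm_mult norm_power)
  also have "\<dots> \<le> (cmod z)\<^sup>2 * (sin\<alpha> * cmod (neg_log_grad z))" by (intro mult_left_mono neg_log_grad_bounds z) auto
  also have "\<dots> = sin\<alpha> * cmod (ext_z w)"
    using True by (simp add: ext_z_def z_def norm_mult norm_power)
  finally show ?thesis .
qed (use cs in \<open>simp add: ext_zbar_def\<close>)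

lemma neg_log_grad_continuous: "continuous_on (ball 0 1 - {0}) neg_log_grad"
proof -
  have h: "continuous_on (ball 0 1 - {0}) g" if "g holomorphic_on ball 0 1" for g :: "complex \<Rightarrow> complex"
    using that by (meson Diff_subset holomorphic_on_imp_continuous_on holomorphic_on_subset)
  have d2: "deriv (deriv f) holomorphic_on ball 0 1" by (rule holomorphic_deriv[OF deriv_hol open_ball])
  show ?thesis
    unfolding neg_log_grad_def[abs_def] weight_def
    using cs nonzero by (intro continuous_intros h deriv_hol d2) auto
qed

lemma ext_z_measurable: "ext_z \<in> borel_measurable borel" "ext_zbar \<in> borel_measurable borel"
proof -
  have o: "open (- cball (0::complex) 1)" by auto
  have inv: "continuous_on (- cball 0 1) (\<lambda>w::complex. 1 / cnj w)"
    by (intro continuous_intros) auto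
  have im: "(\<lambda>w. 1 / cnj w) ` (- cball 0 1) \<subseteq> ball 0 1 - {0}"
    by (intro image_subsetI inverse_cnj_bij(2))
  have comp: "continuous_on (- cball 0 1) (\<lambda>w. g (1 / cnj w))"
    if "continuous_on (ball 0 1 - {0}) g" for g :: "complex \<Rightarrow> 'b::topological_space"
    using that inv im by (rule continuous_on_compose2)
  have fc: "continuous_on (ball 0 1) (deriv f)" using deriv_hol by (rule holomorphic_on_imp_continuous_on)
  then have fc': "continuous_on (ball 0 1 - {0}) (deriv f)" by (rule continuous_on_subset) auto
  show "ext_z \<in> borel_measurable borel"
    unfolding ext_z_def[abs_def]
    by (intro borel_measurable_add borel_measurable_continuous_on_indicator fc
        continuous_intros inv comp[OF neg_log_grad_continuous]) (use o in auto)
  show "ext_zbar \<in> borel_measurable borel"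
    unfolding ext_zbar_def[abs_def]
    by (intro borel_measurable_continuous_on_indicator
        continuous_intros inv comp[OF neg_log_grad_continuous] comp[OF fc'] comp[OF height_continuous]) (use o in auto)
qed

text \<open>
  On both sides of the circle the derivative is bounded by a multiple of \<open>\<bar>f'\<bar>\<close>, outside at the reflected point
  \<open>1 / cnj w\<close>, whose distance from the circle is \<open>(\<bar>w\<bar> - 1) / \<bar>w\<bar>\<close>.
\<close>

lemma ext_z_bound:
  assumes R: "1 \<le> R" and w: "cmod w \<le> R"
  shows "cmod (ext_z w) \<le> 2 / cos\<alpha> * (2 * R) powr \<gamma> * \<bar>1 - cmod w\<bar> powr (- \<gamma>)"
proof -
  have c2: "1 \<le> 2 / cos\<alpha>" using cs by (simp add: field_simps)
  consider "cmod w < 1" | "cmod w = 1" | "1 < cmod w" by linarith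
  then show ?thesis
  proof cases
    case 1
    then have "cmod (ext_z w) \<le> (2 / (1 - cmod w)) powr \<gamma>"
      using deriv_growth[of w] by (simp add: ext_z_def)
    also have "\<dots> = 2 powr \<gamma> * \<bar>1 - cmod w\<bar> powr (- \<gamma>)"
      using 1 by (simp add: powr_divide powr_minus_divide)
    also have "\<dots> \<le> (2 / cos\<alpha> * (2 * R) powr \<gamma>) * \<bar>1 - cmod w\<bar> powr (- \<gamma>)"
    proof (rule mult_right_mono)
      have "1 * 2 powr \<gamma> \<le> 2 / cos\<alpha> * (2 * R) powr \<gamma>"
        using c2 R gamma cs by (intro mult_mono powr_mono2) auto
      then show "2 powr \<gamma> \<le> 2 / cos\<alpha> * (2 * R) powr \<gamma>" by simp
    qed simp
    finally show ?thesis .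
  next
    case 2
    then show ?thesis by (simp add: ext_z_def)
  next
    case 3
    then have w': "w \<in> - cball 0 1" by simp
    define z where "z = 1 / cnj w"
    have z: "z \<in> ball 0 1" "z \<noteq> 0" using inverse_cnj_bij(2)[OF w'] by (auto simp: z_def)
    have zw: "cmod z = 1 / cmod w" by (simp add: z_def norm_divide)
    have "cmod (ext_z w) = (cmod z)\<^sup>2 * cmod (neg_log_grad z)"
      using w' by (simp add: ext_z_def z_def norm_mult norm_power)
    also have "\<dots> \<le> 2 / cos\<alpha> * cmod (deriv f z)" by (rule neg_log_grad_bounds(2)[OF z])
    also have "\<dots> \<le> 2 / cos\<alpha> * (2 / (1 - cmod z)) powr \<gamma>"
      using cs by (intro mult_left_mono deriv_growth z) auto
    also have "2 / (1 - cmod z) = 2 * cmod w / (cmod w - 1)"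
    proof -
      have "w \<noteq> 0" using 3 by auto
      then show ?thesis unfolding zw using 3 by (simp add: field_simps)
    qed
    also have "(2 * cmod w / (cmod w - 1)) powr \<gamma> = (2 * cmod w) powr \<gamma> * \<bar>1 - cmod w\<bar> powr (- \<gamma>)"
      using 3 by (simp add: powr_divide powr_minus_divide)
    also have "2 / cos\<alpha> * \<dots> \<le> 2 / cos\<alpha> * ((2 * R) powr \<gamma> * \<bar>1 - cmod w\<bar> powr (- \<gamma>))"
      using cs w gamma by (intro mult_left_mono mult_right_mono powr_mono2) auto
    finally show ?thesis by (simp add: mult.assoc)
  qed
qed

lemma extension_quasiconformal: "quasiconformal_on sin\<alpha> extension UNIV"
proof -
  have homeo: "\<exists>F'. homeomorphism UNIV (extension ` UNIV) extension F'"
    using invariance_of_domain_homeomorphism[of UNIV extension] extension_continuous extension_inj by auto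
  have bar: "cmod (ext_zbar w) \<le> 2 / cos\<alpha> * (2 * R) powr \<gamma> * \<bar>1 - cmod w\<bar> powr (- \<gamma>)"
    if "1 \<le> R" "cmod w \<le> R" for R w
  proof -
    have "cmod (ext_zbar w) \<le> 1 * cmod (ext_z w)"
      using ext_zbar_le[of w] cs by (meson less_imp_le mult_right_mono norm_ge_zero order_trans)
    then show ?thesis using ext_z_bound[OF that] by simp
  qed
  have loc: "locally_integrable_on ext_z UNIV" "locally_integrable_on ext_zbar UNIV"
    by (rule locally_integrable_on_power_distance_circle[where C = "\<lambda>R. 2 / cos\<alpha> * (2 * R) powr \<gamma>",
          OF gamma _ ext_z_bound] locally_integrable_on_power_distance_circle[where C = "\<lambda>R. 2 / cos\<alpha> * (2 * R) powr \<gamma>",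
          OF gamma _ bar]; (rule ext_z_measurable | assumption))+
  have der: "(extension has_derivative (\<lambda>v. ext_z z * v + ext_zbar z * cnj v)) (at z)" if "z \<notin> sphere 0 1" for z
    using that by (intro extension_has_derivative) simp
  have "has_distr_deriv_z extension ext_z UNIV" "has_distr_deriv_zbar extension ext_zbar UNIV"
    using distributional_derivatives_off_thin_set[OF extension_continuous finite_sections_circle der
        ext_z_measurable(1) loc(1) ext_z_measurable(2) loc(2)] by blast+
  then show ?thesis
    unfolding quasiconformal_on_def using cs homeo ext_zbar_le by auto
qed

end

theorem theorem5p1:
  fixes f :: "complex \<Rightarrow> complex" and \<gamma> :: real
  assumes "f \<in> class_A"
    and "0 \<le> \<gamma>" and "\<gamma> < 1"
    and "\<And>z. z \<in> ball 0 1 \<Longrightarrow> deriv f z \<noteq> 0 \<and> \<bar>Arg (deriv f z)\<bar> \<le> \<gamma> * pi / 2"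
  shows "f \<in> class_R \<and> has_quasiconformal_extension (sin (\<gamma> * pi / 2)) f"
proof -
  interpret sector_derivative f \<gamma>
    using assms by unfold_locales (auto simp: class_A_def)
  have "f \<in> class_R" using assms(1) Re_deriv_pos by (simp add: class_R_def)
  moreover have "extension z = f z" if "z \<in> ball 0 1" for z
    using that closed_ext(2)[OF that] by (simp add: extension_def)
  moreover have "inj_on f (ball 0 1)"
    using inj_on_subset[OF extension_inj subset_UNIV] \<open>\<And>z. z \<in> ball 0 1 \<Longrightarrow> extension z = f z\<close>
    by (metis inj_on_cong)
  ultimately show ?thesis
    using assms(1) extension_quasiconformal extension_surj unfolding has_quasiconformal_extension_def sin\<alpha>_def by blast
qed

end
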